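(* Let $X_1,X_2,\dots$ be i.i.d. real random variables with $P(X_1>0)>0$, $S_n=\sum_{i=1}^nX_i$, $S_0=0$, and let $Y_n=y+S_n$ be the random walk started in $y\in\mathbb R$ under $P_y$. Let $0<\rho\le1$ and let $g:\mathbb R\to[0,\infty)$ satisfy $\{y:g(y)>0\}=\{y:y>b\}$ for some $b\in\mathbb R\cup\{-\infty\}$. Let $V$, $\tau_+$, $\tau_y$, $\phi$ be as defined in the context and put $\alpha^*=\inf\{z>b:\phi(z)\le g(z)\}$. Then $$\alpha^*=\inf\Bigl\{z>b:\ E\Bigl(\rho^{\tau_+}\frac{g(z+S_{\tau_+})}{g(z)}\Bigr)\le1\Bigr\}.$$ Assume now that $g$ is increasing and log-concave on $\{y:y>\alpha^*\}$, and that for every $y\in\mathbb R$: $E_y\sup_n\rho^ng(Y_n)<\infty$ and $\rho^ng(Y_n)\to0$ $P_y$-a.s. as $n\to\infty$. (i) If $g(\alpha^* )\ge\phi(\alpha^* )$, then $\tau^*=\inf\{n\ge0:Y_n\ge\alpha^*\}$ is an optimal stopping time, i.e. $E_y\rho^{\tau^*}g(Y_{\tau^*})=V(y)$ for all $y\in\mathbb R$ (so the optimal threshold is $\alpha^*$). (ii) If $g(\alpha^* )\le\phi(\alpha^* )$, then $\tau^*=\inf\{n\ge0:Y_n>\alpha^*\}$ is an optimal stopping time, i.e. $E_y\rho^{\tau^*}g(Y_{\tau^*})=V(y)$ for all $y\in\mathbb R$.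
   Context: Stopping times are taken with respect to a filtration $(\mathcal A_n)_{n\in\mathbb N_0}$ for which the random walk is a Markov process (e.g. $\mathcal A_n=\sigma(X_1,\dots,X_n)$), and may take the value $+\infty$. Conventions: $Y_\infty=\Delta$ for an extra state $\Delta\notin\mathbb R$, $g(\Delta)=0$, $\rho^\infty=0$ (also when $\rho=1$), so rewards are $0$ on $\{\tau=\infty\}$; $\inf\emptyset=\infty$. $g$ is measurable. Value function: $V(y)=\sup_\tau E_y\rho^\tau g(Y_\tau)$ over all stopping times $\tau$. $\tau_y=\inf\{n>0:Y_n>y\}$, $\phi(y)=E_y\rho^{\tau_y}g(Y_{\tau_y})$, and $\tau_+=\inf\{n>0:S_n>0\}$; for the random walk $\phi(y)=E\rho^{\tau_+}g(y+S_{\tau_+})$, and expressions $\rho^{\tau_+}g(z+S_{\tau_+})$ are $0$ on $\{\tau_+=\infty\}$. "Increasing" means non-decreasing. Log-concave on a set means that $\log g$ is concave there.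
   Formalization: g is assumed increasing on the closed half-line {y ≥ α*} (log-concave on {y > α*}), since with g increasing only on {y > α*} the value g(α* ) may exceed later values and part (i) fails. *)

theory Defs
  imports "HOL-Probability.Probability"
begin

text \<open>
  A sequence \<open>X\<close> of increments is used at the indices \<open>1, 2, \<dots>\<close> only; \<open>X 0\<close> plays no role.
  The random walk under \<open>P\<^sub>y\<close> is realised as \<open>y + S\<^sub>n\<close> on one probability space.
\<close>

definition iid_increments :: "'a measure \<Rightarrow> (nat \<Rightarrow> 'a \<Rightarrow> real) \<Rightarrow> bool" where
  "iid_increments M X \<longleftrightarrow>
     prob_space.indep_vars M (\<lambda>_. borel) X {1..} \<and>
     (\<forall>i\<ge>1. distr M borel (X i) = distr M borel (X 1))"

definition psum :: "(nat \<Rightarrow> 'a \<Rightarrow> real) \<Rightarrow> nat \<Rightarrow> 'a \<Rightarrow> real" where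
  "psum X n \<omega> = (\<Sum>i=1..n. X i \<omega>)"

definition walk :: "(nat \<Rightarrow> 'a \<Rightarrow> real) \<Rightarrow> real \<Rightarrow> nat \<Rightarrow> 'a \<Rightarrow> real" where
  "walk X y n \<omega> = y + psum X n \<omega>"

definition markov_process :: "'a measure \<Rightarrow> (nat \<Rightarrow> 'a measure) \<Rightarrow> (nat \<Rightarrow> 'a \<Rightarrow> real) \<Rightarrow> bool" where
  "markov_process M A Y \<longleftrightarrow>
     filtration (space M) A \<and>
     (\<forall>n. subalgebra M (A n)) \<and>
     (\<forall>n. Y n \<in> borel_measurable (A n)) \<and>
     (\<forall>n. \<forall>B \<in> sets borel. AE \<omega> in M.
        real_cond_exp M (A n) (\<lambda>\<omega>. indicator B (Y (Suc n) \<omega>)) \<omega> =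
        real_cond_exp M (vimage_algebra (space M) (Y n) borel) (\<lambda>\<omega>. indicator B (Y (Suc n) \<omega>)) \<omega>)"

text \<open>
  Stopping times with values in \<open>{0, 1, \<dots>, \<infinity>}\<close>. The filtration is extended by \<open>M\<close> at the
  index \<open>\<infinity>\<close>, where the condition \<open>\<tau> \<le> \<infinity>\<close> is void.
\<close>

definition stop_time :: "'a measure \<Rightarrow> (nat \<Rightarrow> 'a measure) \<Rightarrow> ('a \<Rightarrow> enat) \<Rightarrow> bool" where
  "stop_time M A \<tau> \<longleftrightarrow> stopping_time (case_enat A M) \<tau>"

text \<open>The infimum is taken in \<^typ>\<open>enat\<close>, so it is \<open>\<infinity>\<close> for the empty set.\<close>

definition first_time :: "(nat \<Rightarrow> bool) \<Rightarrow> enat" where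
  "first_time Q = Inf (enat ` {n. Q n})"

text \<open>
  The discounted reward \<open>\<rho>\<^sup>\<tau> h(Z\<^sub>\<tau>)\<close> for a nonnegative function \<open>h\<close>, equal to \<open>0\<close> on \<open>{\<tau> = \<infinity>}\<close>.
  Expectations of rewards are nonnegative integrals and may be infinite.
\<close>

definition reward :: "real \<Rightarrow> (real \<Rightarrow> real) \<Rightarrow> (nat \<Rightarrow> 'a \<Rightarrow> real) \<Rightarrow> ('a \<Rightarrow> enat) \<Rightarrow> 'a \<Rightarrow> ennreal" where
  "reward \<rho> h Z \<tau> \<omega> = (case \<tau> \<omega> of enat n \<Rightarrow> ennreal (\<rho> ^ n * h (Z n \<omega>)) | \<infinity> \<Rightarrow> 0)"

definition value_fun ::
    "'a measure \<Rightarrow> (nat \<Rightarrow> 'a measure) \<Rightarrow> (nat \<Rightarrow> 'a \<Rightarrow> real) \<Rightarrow> real \<Rightarrow> (real \<Rightarrow> real) \<Rightarrow> real \<Rightarrow> ennreal" where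
  "value_fun M A X \<rho> g y =
     (SUP \<tau> \<in> {\<tau>. stop_time M A \<tau>}. \<integral>\<^sup>+ \<omega>. reward \<rho> g (walk X y) \<tau> \<omega> \<partial>M)"

definition tau_above :: "(nat \<Rightarrow> 'a \<Rightarrow> real) \<Rightarrow> real \<Rightarrow> 'a \<Rightarrow> enat" where
  "tau_above X y \<omega> = first_time (\<lambda>n. n > 0 \<and> walk X y n \<omega> > y)"

definition tau_plus :: "(nat \<Rightarrow> 'a \<Rightarrow> real) \<Rightarrow> 'a \<Rightarrow> enat" where
  "tau_plus X \<omega> = first_time (\<lambda>n. n > 0 \<and> psum X n \<omega> > 0)"

definition phi ::
    "'a measure \<Rightarrow> (nat \<Rightarrow> 'a \<Rightarrow> real) \<Rightarrow> real \<Rightarrow> (real \<Rightarrow> real) \<Rightarrow> real \<Rightarrow> ennreal" where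
  "phi M X \<rho> g y = (\<integral>\<^sup>+ \<omega>. reward \<rho> g (walk X y) (tau_above X y) \<omega> \<partial>M)"

definition alpha_star ::
    "'a measure \<Rightarrow> (nat \<Rightarrow> 'a \<Rightarrow> real) \<Rightarrow> real \<Rightarrow> (real \<Rightarrow> real) \<Rightarrow> ereal \<Rightarrow> ereal" where
  "alpha_star M X \<rho> g b = Inf (ereal ` {z. ereal z > b \<and> phi M X \<rho> g z \<le> ennreal (g z)})"

text \<open>
  A rule given by one random time for each starting point is optimal if, for every starting
  point, it is a stopping time attaining the value function.
\<close>

definition optimal_rule ::
    "'a measure \<Rightarrow> (nat \<Rightarrow> 'a measure) \<Rightarrow> (nat \<Rightarrow> 'a \<Rightarrow> real) \<Rightarrow> real \<Rightarrow> (real \<Rightarrow> real) \<Rightarrow>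
     (real \<Rightarrow> 'a \<Rightarrow> enat) \<Rightarrow> bool" where
  "optimal_rule M A X \<rho> g T \<longleftrightarrow>
     (\<forall>y. stop_time M A (T y) \<and>
          (\<integral>\<^sup>+ \<omega>. reward \<rho> g (walk X y) (T y) \<omega> \<partial>M) = value_fun M A X \<rho> g y)"

end

theory Submission
  imports Defs
begin

text \<open>
  Write \<open>C\<close> for the stopping region above \<open>\<alpha>\<close> and \<open>F = (g - \<phi>) 1\<^sub>C\<close>. For \<open>s > 0\<close>, log-concavity makes
  \<open>g (y + s) / g y\<close>, hence \<open>\<phi> / g\<close>, decreasing in \<open>y\<close> above \<open>\<alpha>\<close>, so that
  \<open>F = g (1 - \<phi> / g)\<close> is a product of nonnegative increasing functions there, and \<open>F\<close> is increasing.
  Let \<open>W y\<close> be the expected sum of \<open>\<rho>\<^sup>n F (Y\<^sub>n)\<close> over the times \<open>n\<close> at which the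
  walk attains a strict record. Iterating \<open>g \<le> F + \<phi>\<close>, which is an equality on \<open>C\<close>, along the records
  gives \<open>g \<le> W\<close>, with equality on \<open>C\<close>; the strong Markov property at the entrance time of \<open>C\<close> then
  identifies \<open>W\<close> with the expected reward of that time. Finally \<open>W\<close> is excessive:
  after one step the sum also picks up times \<open>n + 1\<close> with \<open>Y\<^sub>n\<^sub>+\<^sub>1 > max (Y\<^sub>1, \<dots>, Y\<^sub>n)\<close> but
  \<open>Y\<^sub>n\<^sub>+\<^sub>1 \<le> Y\<^sub>0\<close>; there \<open>F (Y\<^sub>n\<^sub>+\<^sub>1) \<le> F (Y\<^sub>0)\<close>, and the expected number of such
  times is at most \<open>1\<close>. Hence no stopping time earns more than \<open>W\<close>.
\<close>

section \<open>First passage times and rewards\<close>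

lemma first_time_eq_enat_iff: "first_time Q = enat n \<longleftrightarrow> Q n \<and> (\<forall>m<n. \<not> Q m)"
proof
  assume *: "first_time Q = enat n"
  have "\<exists>k. Q k"
  proof (rule ccontr)
    assume "\<not> (\<exists>k. Q k)"
    then show False
      using * by (simp add: first_time_def Inf_enat_def)
  qed
  then obtain k where "Q k" ..
  then have "Inf (enat ` {n. Q n}) \<in> enat ` {n. Q n}"
    by (intro wellorder_InfI[of "enat k"]) auto
  moreover have "\<not> Q m" if "m < n" for m
  proof
    assume "Q m"
    then have "Inf (enat ` {n. Q n}) \<le> enat m"
      by (intro Inf_lower) auto
    with * that show False
      by (simp add: first_time_def)
  qed
  ultimately show "Q n \<and> (\<forall>m<n. \<not> Q m)"
    using * by (auto simp: first_time_def)
next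
  assume *: "Q n \<and> (\<forall>m<n. \<not> Q m)"
  show "first_time Q = enat n"
    unfolding first_time_def
  proof (rule antisym)
    show "Inf (enat ` {n. Q n}) \<le> enat n"
      using * by (intro Inf_lower) auto
    show "enat n \<le> Inf (enat ` {n. Q n})"
      using * by (intro Inf_greatest) (auto simp: not_less[symmetric])
  qed
qed

lemma first_time_eq_infinity_iff: "first_time Q = \<infinity> \<longleftrightarrow> (\<forall>n. \<not> Q n)"
proof
  assume *: "first_time Q = \<infinity>"
  show "\<forall>n. \<not> Q n"
  proof (rule ccontr)
    assume "\<not> (\<forall>n. \<not> Q n)"
    then obtain n where "Q n" "\<forall>m<n. \<not> Q m"
      using exists_least_iff[of Q] by blast
    then show False
      using * first_time_eq_enat_iff[of Q n] by simp
  qed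
next
  assume "\<forall>n. \<not> Q n"
  then show "first_time Q = \<infinity>"
    using first_time_eq_enat_iff[of Q] by (metis not_enat_eq)
qed

lemma first_time_le_iff: "first_time Q \<le> enat n \<longleftrightarrow> (\<exists>m\<le>n. Q m)"
proof (cases "first_time Q")
  case (enat k)
  then show ?thesis
    using first_time_eq_enat_iff[of Q k] by (auto simp: not_less[symmetric]) 
next
  case infinity
  then show ?thesis
    using first_time_eq_infinity_iff[of Q] by simp
qed

lemma first_time_shift:
  assumes "\<And>n. n < N \<Longrightarrow> \<not> Q n"
  shows "first_time Q = enat N + first_time (\<lambda>k. Q (N + k))"
proof (cases "first_time (\<lambda>k. Q (N + k))")
  case (enat k)
  then have "Q (N + k)" "\<And>j. j < k \<Longrightarrow> \<not> Q (N + j)"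
    by (auto simp: first_time_eq_enat_iff)
  moreover have "\<not> Q m" if "m < N + k" for m
    using assms[of m] calculation(2)[of "m - N"] that by (cases "m < N") auto
  ultimately have "first_time Q = enat (N + k)"
    by (auto simp: first_time_eq_enat_iff)
  then show ?thesis
    using enat by simp
next
  case infinity
  then have "\<not> Q n" for n
    using assms[of n] by (cases "n < N") (auto simp: first_time_eq_infinity_iff dest: spec[of _ "n - N"])
  then show ?thesis
    using infinity first_time_eq_infinity_iff[of Q] by simp
qed

text \<open>Splitting by the possible finite values of \<open>\<tau>\<close> gives measurability
  termwise and lets expectations be taken term by term. At most one term is nonzero, and the value
  \<infinity> contributes none.\<close>

lemma reward_eq_suminf:
  "reward \<rho> h Z \<tau> \<omega> = (\<Sum>n. if \<tau> \<omega> = enat n then ennreal (\<rho> ^ n * h (Z n \<omega>)) else 0)"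
proof (cases "\<tau> \<omega>")
  case (enat k)
  then have "(\<lambda>n. if \<tau> \<omega> = enat n then ennreal (\<rho> ^ n * h (Z n \<omega>)) else 0) =
      (\<lambda>n. if n = k then ennreal (\<rho> ^ k * h (Z k \<omega>)) else 0)"
    by auto
  then show ?thesis
    using enat sums_unique[OF sums_single[of k "\<lambda>_. ennreal (\<rho> ^ k * h (Z k \<omega>))"]]
    by (simp add: reward_def)
qed (simp add: reward_def)

text \<open>Process, random time and path may all vary with \<open>x\<close>, so that the same rule
  yields the joint measurability needed for iterated integrals.\<close>

lemma borel_measurable_reward:
  assumes [measurable]: "h \<in> borel_measurable borel"
    "\<And>n. (\<lambda>x. Z x n (f x)) \<in> borel_measurable N"
    "\<And>n. Measurable.pred N (\<lambda>x. \<tau> x (f x) = enat n)"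
  shows "(\<lambda>x. reward \<rho> h (Z x) (\<tau> x) (f x)) \<in> borel_measurable N"
  unfolding reward_eq_suminf by measurable

lemma reward_shift:
  assumes "0 \<le> \<rho>" "\<tau> \<omega> = enat N + \<tau>' \<omega>'" "\<And>k. Z (N + k) \<omega> = Z' k \<omega>'"
  shows "reward \<rho> h Z \<tau> \<omega> = ennreal (\<rho> ^ N) * reward \<rho> h Z' \<tau>' \<omega>'"
  using assms by (cases "\<tau>' \<omega>'")
    (auto simp: reward_def power_add mult.assoc ennreal_mult'[symmetric])

lemma reward_cong:
  assumes "\<tau> \<omega> = \<tau>' \<omega>'" "\<And>n. h (Z n \<omega>) = h' (Z' n \<omega>')"
  shows "reward \<rho> h Z \<tau> \<omega> = reward \<rho> h' Z' \<tau>' \<omega>'"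
  using assms by (simp add: reward_def split: enat.split)

section \<open>Log-concave functions\<close>

text \<open>Strictly above \<alpha>, both \<open>y\<close> and \<open>x + s\<close> are convex
  combinations of \<open>x\<close> and \<open>y + s\<close>, with exchanged weights; adding the two
  concavity inequalities for \<open>ln g\<close> makes the weights cancel. The cross-multiplied form
  avoids dividing by \<open>g x\<close>, which may vanish at the boundary point \<alpha>.\<close>

lemma log_concave_cross:
  fixes g :: "real \<Rightarrow> real" and \<alpha> :: ereal
  assumes mono: "mono_on {y. \<alpha> \<le> ereal y} g"
    and concave: "concave_on {y. \<alpha> < ereal y} (\<lambda>y. ln (g y))"
    and pos: "\<And>y. \<alpha> < ereal y \<Longrightarrow> 0 < g y"
    and x: "\<alpha> \<le> ereal x" and "x \<le> y" and "0 < s"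
  shows "g x * g (y + s) \<le> g y * g (x + s)"
proof (cases "x = y")
  case False
  with \<open>x \<le> y\<close> have "x < y"
    by simp
  have above: "\<alpha> < ereal v" if "x < v" for v
    using x that by (simp add: le_less_trans)
  have inner: "g u * g (y + s) \<le> g y * g (u + s)" if u: "\<alpha> < ereal u" "u < y" for u
  proof -
    \<comment> \<open>The weight is chosen so that \<open>y = (1 - t) * u + t * (y + s)\<close>;
      then \<open>u + s\<close> is the combination with the weights exchanged.\<close>
    define t where "t = (y - u) / (y + s - u)"
    have L: "0 < y + s - u"
      using u \<open>0 < s\<close> by simp
    have t: "0 \<le> t" "t \<le> 1" "t * (y + s - u) = y - u"
      using u \<open>0 < s\<close> L by (auto simp: t_def field_simps)
    have S: "\<alpha> < ereal u" "\<alpha> < ereal (y + s)" "\<alpha> < ereal y" "\<alpha> < ereal (u + s)"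
      using u \<open>0 < s\<close> by (auto intro: less_trans)
    have "(1 - t) * u + t * (y + s) = y" "(1 - t) * (y + s) + t * u = u + s"
      using t(3) by (simp_all add: algebra_simps)
    then have "(1 - t) * ln (g u) + t * ln (g (y + s)) \<le> ln (g y)"
        "(1 - t) * ln (g (y + s)) + t * ln (g u) \<le> ln (g (u + s))"
      using concave_onD[OF concave t(1,2), of u "y + s"] concave_onD[OF concave t(1,2), of "y + s" u] S
      by simp_all
    then have "ln (g u) + ln (g (y + s)) \<le> ln (g y) + ln (g (u + s))"
      by (simp add: algebra_simps)
    then have "ln (g u * g (y + s)) \<le> ln (g y * g (u + s))"
      using S by (simp add: ln_mult_pos pos)
    then show ?thesis
      using S by (simp add: pos)
  qed
  show ?thesis
  proof (cases "\<alpha> < ereal x")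
    case True
    then show ?thesis
      using inner \<open>x < y\<close> by blast
  next
    \<comment> \<open>\<open>\<alpha> = x\<close>: only monotonicity is available at \<open>x\<close> itself, so let \<open>u\<close> decrease to \<open>x\<close>\<close>
    case False
    have "open {v. \<alpha> < ereal v}"
      by (intro open_Collect_less continuous_intros)
    moreover have "continuous_on {v. \<alpha> < ereal v} g"
    proof -
      have "continuous_on {v. \<alpha> < ereal v} (\<lambda>v. - ln (g v))"
        using concave \<open>open {v. \<alpha> < ereal v}\<close> by (intro convex_on_continuous) (simp_all add: concave_on_def)
      then have "continuous_on {v. \<alpha> < ereal v} (\<lambda>v. exp (- (- ln (g v))))"
        by (rule continuous_on_exp[OF continuous_on_minus])
      then show ?thesis
        by (rule continuous_on_eq) (simp add: pos)
    qed
    ultimately have "isCont g (x + s)"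
      using above[of "x + s"] \<open>0 < s\<close> by (simp add: continuous_on_eq_continuous_at)
    then have "((\<lambda>u. g (u + s)) \<longlongrightarrow> g (x + s)) (at_right x)"
      by (rule isCont_tendsto_compose) (intro tendsto_intros)
    then have "((\<lambda>u. g y * g (u + s)) \<longlongrightarrow> g y * g (x + s)) (at_right x)"
      by (intro tendsto_intros)
    moreover have "eventually (\<lambda>u. g x * g (y + s) \<le> g y * g (u + s)) (at_right x)"
      unfolding eventually_at_right_field
    proof (intro exI[of _ y] conjI allI impI)
      fix u assume u: "x < u" "u < y"
      have "g x \<le> g u"
        using u x above[of u] by (intro mono_onD[OF mono]) auto
      moreover have "0 \<le> g (y + s)"
        using above[of "y + s"] \<open>x < y\<close> \<open>0 < s\<close> pos[of "y + s"] by simp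
      ultimately have "g x * g (y + s) \<le> g u * g (y + s)"
        by (rule mult_right_mono)
      also have "\<dots> \<le> g y * g (u + s)"
        using u above by (intro inner) auto
      finally show "g x * g (y + s) \<le> g y * g (u + s)" .
    qed (rule \<open>x < y\<close>)
    ultimately show ?thesis
      by (rule tendsto_lowerbound) simp
  qed
qed simp

text \<open>The left difference is \<open>u * (1 - p / u)\<close>, and \<open>cross\<close> says
  \<open>q / v \<le> p / u\<close>, so both factors grow. The proof multiplies by \<open>u\<close>
  instead of dividing; for \<open>u = 0\<close> the truncated difference on the left is 0.\<close>

lemma ennreal_diff_mono_of_cross:
  fixes u v :: real and p q :: ennreal
  assumes "0 \<le> u" "u \<le> v" and p: "p \<le> ennreal u" and cross: "ennreal u * q \<le> ennreal v * p"
  shows "ennreal u - p \<le> ennreal v - q"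
proof (cases "u = 0")
  case False
  with assms have u: "0 < u"
    by simp
  obtain p' where p': "p = ennreal p'" "0 \<le> p'"
    using p by (cases p) (auto simp: top_unique)
  \<comment> \<open>An infinite \<open>q\<close> would make the left side of \<open>cross\<close>
    infinite, whereas \<open>v * p\<close> is finite.\<close>
  have "q \<noteq> \<top>"
    using cross u by (auto simp: p' ennreal_mult_top ennreal_mult_eq_top_iff top_unique)
  then obtain q' where q': "q = ennreal q'" "0 \<le> q'"
    by (cases q) auto
  have "p' \<le> u"
    using p u by (simp add: p' ennreal_le_iff)
  have "u * q' \<le> v * p'"
    using cross u \<open>u \<le> v\<close> p'(2) q'(2)
    by (simp add: p' q' ennreal_mult[symmetric] ennreal_le_iff)
  moreover have "u * (u - p') \<le> v * (u - p')"
    using \<open>u \<le> v\<close> \<open>p' \<le> u\<close> by (intro mult_right_mono) auto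
  ultimately have "u * (u - p') \<le> u * (v - q')"
    by (simp add: algebra_simps)
  then have "u - p' \<le> v - q'"
    using u by simp
  then show ?thesis
    using p'(2) q'(2) by (simp add: p' q' ennreal_minus ennreal_leI)
qed simp

lemma ennreal_suminf_shift:
  fixes f :: "nat \<Rightarrow> ennreal"
  assumes "\<And>n. n < m \<Longrightarrow> f n = 0"
  shows "(\<Sum>n. f n) = (\<Sum>k. f (m + k))"
  using assms suminf_offset[of f m] by (simp add: add.commute)

section \<open>Records of a path\<close>

text \<open>Increments are indexed from 0, so \<open>z i\<close> stands for
  \<open>X (Suc i)\<close>. Keeping the start \<open>y\<close> apart from the increments lets one
  product measure serve all starting points.\<close>

definition traj :: "real \<Rightarrow> nat \<Rightarrow> (nat \<Rightarrow> real) \<Rightarrow> real" where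
  "traj y n z = y + (\<Sum>i<n. z i)"

definition is_record :: "nat \<Rightarrow> (nat \<Rightarrow> real) \<Rightarrow> bool" where
  "is_record n z \<longleftrightarrow> (\<forall>j<n. traj 0 j z < traj 0 n z)"

text \<open>This is the first record after time \<open>N\<close>, whether or not \<open>N\<close>
  itself is a record; for \<open>N = 0\<close> it is the first ladder epoch, that is,
  \<tau>_+.\<close>

definition next_above :: "nat \<Rightarrow> (nat \<Rightarrow> real) \<Rightarrow> enat" where
  "next_above N z = first_time (\<lambda>n. N < n \<and> (\<forall>j\<le>N. traj 0 j z < traj 0 n z))"

definition hit :: "real set \<Rightarrow> real \<Rightarrow> (nat \<Rightarrow> real) \<Rightarrow> enat" where
  "hit C y z = first_time (\<lambda>n. traj y n z \<in> C)"

lemma traj_0 [simp]: "traj y 0 z = y"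
  by (simp add: traj_def)

lemma traj_less_iff: "traj y i z < traj y j z \<longleftrightarrow> traj 0 i z < traj 0 j z"
  by (simp add: traj_def)

lemma is_record_iff: "is_record n z \<longleftrightarrow> (\<forall>j<n. traj y j z < traj y n z)"
  by (simp add: is_record_def traj_less_iff[of y])

lemma is_record_0 [simp]: "is_record 0 z"
  by (simp add: is_record_def)

lemma traj_comb_seq: "traj y (N + k) (comb_seq N z z') = traj (traj y N z) k z'"
proof -
  have "(\<Sum>i<N + k. comb_seq N z z' i) = (\<Sum>i<N. z i) + (\<Sum>i<k. z' i)"
    by (induction k) (auto simp: comb_seq_def)
  then show ?thesis
    by (simp add: traj_def)
qed

lemma traj_comb_seq_le: "n \<le> N \<Longrightarrow> traj y n (comb_seq N z z') = traj y n z"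
  by (simp add: traj_def comb_seq_def)

lemma traj_Suc_case_nat: "traj y (Suc n) (case_nat x z) = traj (y + x) n z"
  by (simp add: traj_def sum.lessThan_Suc_shift del: sum.lessThan_Suc)

lemma is_record_comb_seq_le: "n \<le> N \<Longrightarrow> is_record n (comb_seq N z z') \<longleftrightarrow> is_record n z"
  by (simp add: is_record_def traj_comb_seq_le)

lemma hit_comb_seq_eq:
  "hit C y (comb_seq N z z') = enat N \<longleftrightarrow> hit C y z = enat N"
  by (simp add: hit_def first_time_eq_enat_iff traj_comb_seq_le)

text \<open>At a record the current value is the maximum so far, so passing all earlier values means
  passing the current one, and this depends on the later increments only. It is the renewal property
  of ladder epochs.\<close>

lemma next_above_comb_seq:
  assumes "is_record N z"
  shows "next_above N (comb_seq N z z') = enat N + next_above 0 z'"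
proof -
  have *: "(\<forall>j\<le>N. traj 0 j (comb_seq N z z') < traj 0 (N + k) (comb_seq N z z')) \<longleftrightarrow>
      0 < traj 0 k z'" for k
  proof -
    have 1: "traj 0 (N + k) (comb_seq N z z') = traj 0 N z + traj 0 k z'"
      unfolding traj_comb_seq by (simp add: traj_def)
    have 2: "traj 0 j z \<le> traj 0 N z" if "j \<le> N" for j
      using assms that by (cases "j = N") (auto simp: is_record_def intro: less_imp_le)
    have "(\<forall>j\<le>N. traj 0 j (comb_seq N z z') < traj 0 (N + k) (comb_seq N z z')) \<longleftrightarrow>
        (\<forall>j\<le>N. traj 0 j z < traj 0 N z + traj 0 k z')"
      using 1 by (simp add: traj_comb_seq_le)
    also have "\<dots> \<longleftrightarrow> 0 < traj 0 k z'"
      using 2 by (smt (verit) order_refl)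
    finally show ?thesis .
  qed
  have "next_above N (comb_seq N z z') = enat N + first_time (\<lambda>k. N < N + k \<and>
      (\<forall>j\<le>N. traj 0 j (comb_seq N z z') < traj 0 (N + k) (comb_seq N z z')))"
    unfolding next_above_def by (rule first_time_shift) simp
  also have "\<dots> = enat N + next_above 0 z'"
    unfolding * next_above_def by simp
  finally show ?thesis .
qed

text \<open>If \<open>Suc N\<close> is no record, its value is at most that of some
  \<open>i \<le> N\<close>, so exceeding all values up to \<open>N\<close> already forces exceeding
  it.\<close>

lemma next_above_Suc:
  "next_above N z = (if is_record (Suc N) z then enat (Suc N) else next_above (Suc N) z)"
proof (cases "is_record (Suc N) z")
  case True
  then have "next_above N z = enat (Suc N)"
    unfolding next_above_def first_time_eq_enat_iff is_record_def by auto
  with True show ?thesis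
    by simp
next
  case False
  then obtain i where i: "i \<le> N" "\<not> traj 0 i z < traj 0 (Suc N) z"
    unfolding is_record_def less_Suc_eq_le by blast
  have "(N < n \<and> (\<forall>j\<le>N. traj 0 j z < traj 0 n z)) \<longleftrightarrow>
      (Suc N < n \<and> (\<forall>j\<le>Suc N. traj 0 j z < traj 0 n z))" for n
  proof
    assume *: "N < n \<and> (\<forall>j\<le>N. traj 0 j z < traj 0 n z)"
    then have "traj 0 i z < traj 0 n z"
      using i by blast
    then have "n \<noteq> Suc N" "traj 0 (Suc N) z < traj 0 n z"
      using i by auto
    with * show "Suc N < n \<and> (\<forall>j\<le>Suc N. traj 0 j z < traj 0 n z)"
      by (auto simp: le_Suc_eq)
  qed auto
  then show ?thesis
    using False by (simp add: next_above_def)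
qed

section \<open>Random walks on the sequence space\<close>

locale random_walk = sequence_space \<mu> for \<mu> :: "real measure" +
  assumes sets_step [measurable_cong]: "sets \<mu> = sets borel"
begin

lemma measurable_traj [measurable]:
  assumes [measurable]: "f \<in> borel_measurable N" "h \<in> measurable N S"
  shows "(\<lambda>x. traj (f x) n (h x)) \<in> borel_measurable N"
proof -
  have [measurable]: "(\<lambda>x. h x i) \<in> borel_measurable N" for i
  proof -
    have "(\<lambda>z. z i) \<in> measurable S \<mu>"
      by measurable
    from measurable_compose[OF assms(2) this] show ?thesis
      by (simp cong: measurable_cong_sets add: measurable_cong_sets[OF refl sets_step])
  qed
  show ?thesis
    unfolding traj_def by measurable
qed

lemma pred_is_record [measurable]:
  assumes [measurable]: "h \<in> measurable N S"
  shows "Measurable.pred N (\<lambda>x. is_record n (h x))"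
  unfolding is_record_def by measurable

lemma pred_next_above [measurable]:
  assumes [measurable]: "h \<in> measurable N S"
  shows "Measurable.pred N (\<lambda>x. next_above m (h x) = enat n)"
  unfolding next_above_def first_time_eq_enat_iff by measurable

lemma pred_hit [measurable]:
  assumes [measurable]: "f \<in> borel_measurable N" "h \<in> measurable N S" "C \<in> sets borel"
  shows "Measurable.pred N (\<lambda>x. hit C (f x) (h x) = enat n)"
  unfolding hit_def first_time_eq_enat_iff by measurable

lemma measurable_reward_next_above [measurable]:
  assumes [measurable]: "f \<in> borel_measurable N" "h \<in> measurable N S" "g \<in> borel_measurable borel"
  shows "(\<lambda>x. reward \<rho> g (traj (f x)) (next_above m) (h x)) \<in> borel_measurable N"
  by (rule borel_measurable_reward) measurable

lemma measurable_reward_hit [measurable]: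
  assumes [measurable]: "f \<in> borel_measurable N" "h \<in> measurable N S" "g \<in> borel_measurable borel"
    "C \<in> sets borel"
  shows "(\<lambda>x. reward \<rho> g (traj (f x)) (hit C (f x)) (h x)) \<in> borel_measurable N"
  by (rule borel_measurable_reward) measurable

text \<open>The Markov property at a fixed time: the first \<open>N\<close> increments of one path
  followed by an independent path have the product law again. Random times are handled by applying
  this for each value \<open>N\<close> separately.\<close>

lemma nn_integral_comb_seq:
  assumes f [measurable]: "f \<in> borel_measurable S"
  shows "(\<integral>\<^sup>+z. f z \<partial>S) = (\<integral>\<^sup>+z. \<integral>\<^sup>+z'. f (comb_seq N z z') \<partial>S \<partial>S)"
proof -
  have "(\<integral>\<^sup>+z. f z \<partial>S) = (\<integral>\<^sup>+z. f z \<partial>distr (S \<Otimes>\<^sub>M S) S (\<lambda>(z, z'). comb_seq N z z'))"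
    by (simp add: PiM_comb_seq)
  also have "\<dots> = (\<integral>\<^sup>+p. f (comb_seq N (fst p) (snd p)) \<partial>(S \<Otimes>\<^sub>M S))"
    by (subst nn_integral_distr) (auto simp: split_beta')
  also have "\<dots> = (\<integral>\<^sup>+z. \<integral>\<^sup>+z'. f (comb_seq N z z') \<partial>S \<partial>S)"
    by (subst P.nn_integral_fst[symmetric]) auto
  finally show ?thesis .
qed

lemma nn_integral_case_nat:
  assumes f [measurable]: "f \<in> borel_measurable S"
  shows "(\<integral>\<^sup>+z. f z \<partial>S) = (\<integral>\<^sup>+x. \<integral>\<^sup>+z. f (case_nat x z) \<partial>S \<partial>\<mu>)"
proof -
  have "(\<integral>\<^sup>+z. f z \<partial>S) = (\<integral>\<^sup>+z. f z \<partial>distr (\<mu> \<Otimes>\<^sub>M S) S (\<lambda>(x, z). case_nat x z))"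
    by (simp add: PiM_iter)
  also have "\<dots> = (\<integral>\<^sup>+p. f (case_nat (fst p) (snd p)) \<partial>(\<mu> \<Otimes>\<^sub>M S))"
    by (subst nn_integral_distr) (auto simp: split_beta')
  also have "\<dots> = (\<integral>\<^sup>+x. \<integral>\<^sup>+z. f (case_nat x z) \<partial>S \<partial>\<mu>)"
    by (subst P.nn_integral_fst[symmetric]) auto
  finally show ?thesis .
qed

section \<open>Records after a first step\<close>

lemma is_record_Suc_case_nat:
  "is_record (Suc n) (case_nat x z) \<longleftrightarrow> is_record n z \<and> 0 < traj 0 (Suc n) (case_nat x z)"
proof -
  have *: "traj 0 (Suc j) (case_nat x z) = traj x j z" for j
    by (simp add: traj_Suc_case_nat)
  show ?thesis
    unfolding is_record_def All_less_Suc2 * by (simp add: traj_less_iff[of x]) auto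
qed

text \<open>
  Shifting by the first increment \<open>x\<close>, the \<open>n\<close>-th term is
  \<open>P (n is a record) - P (n + 1 is a record)\<close>, so the series telescopes.
\<close>

lemma suminf_weak_record_le_1:
  "(\<Sum>n. \<integral>\<^sup>+x. \<integral>\<^sup>+z. (if is_record n z \<and> traj x n z \<le> 0 then 1 else 0) \<partial>S \<partial>\<mu>) \<le> (1 :: ennreal)"
proof -
  define a where "a n = (\<integral>\<^sup>+z. (if is_record n z then 1 else 0) \<partial>S :: ennreal)" for n
  define c where "c n = (\<integral>\<^sup>+x. \<integral>\<^sup>+z. (if is_record n z \<and> traj x n z \<le> 0 then 1 else 0) \<partial>S \<partial>\<mu> :: ennreal)" for n
  have step: "a n = a (Suc n) + c n" for n
  proof -
    have "a (Suc n) + c n = (\<integral>\<^sup>+x. \<integral>\<^sup>+z. (if is_record (Suc n) (case_nat x z) then 1 else 0) \<partial>S \<partial>\<mu>) + c n"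
      unfolding a_def by (subst nn_integral_case_nat) auto
    also have "\<dots> = (\<integral>\<^sup>+x. \<integral>\<^sup>+z. (if is_record n z \<and> 0 < traj x n z then 1 else 0) \<partial>S \<partial>\<mu>) + c n"
      by (simp add: is_record_Suc_case_nat traj_Suc_case_nat)
    also have "\<dots> = (\<integral>\<^sup>+x. \<integral>\<^sup>+z. (if is_record n z \<and> 0 < traj x n z then 1 else 0) +
        (if is_record n z \<and> traj x n z \<le> 0 then 1 else 0) \<partial>S \<partial>\<mu>)"
      unfolding c_def by (subst nn_integral_add[symmetric], measurable, subst nn_integral_add[symmetric]) auto
    also have "\<dots> = (\<integral>\<^sup>+x. a n \<partial>\<mu>)"
      unfolding a_def by (intro nn_integral_cong) auto
    also have "\<dots> = a n"
      by (simp add: M.emeasure_space_1)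
    finally show ?thesis ..
  qed
  \<comment> \<open>The telescoping is kept in additive form, which avoids subtraction in
    \<open>ennreal\<close>.\<close>
  have "(\<Sum>i<n. c i) + a n = 1" for n
  proof (induction n)
    case 0
    then show ?case
      by (simp add: a_def emeasure_space_1)
  next
    case (Suc n)
    then show ?case
      using step[of n] by (simp add: ac_simps)
  qed
  then have "(\<Sum>i<n. c i) \<le> 1" for n
    by (metis le_iff_add)
  then show ?thesis
    unfolding c_def[symmetric] by (intro suminf_le_const) auto
qed

text \<open>This is \<phi> on the sequence space, with \<open>next_above 0\<close> in the place of
  \<tau>_+.\<close>

definition ladder_reward :: "real \<Rightarrow> (real \<Rightarrow> real) \<Rightarrow> real \<Rightarrow> ennreal" where
  "ladder_reward \<rho> g y = (\<integral>\<^sup>+z. reward \<rho> g (traj y) (next_above 0) z \<partial>S)"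

lemma measurable_ladder_reward [measurable]:
  "g \<in> borel_measurable borel \<Longrightarrow> ladder_reward \<rho> g \<in> borel_measurable borel"
  unfolding ladder_reward_def by measurable

text \<open>The inequality already holds path by path: at the ladder epoch the sum \<open>s\<close>
  of the increments is positive, so \<open>cross\<close> applies to it, and both sides carry the
  same discount.\<close>

lemma ladder_reward_cross:
  assumes [measurable]: "g \<in> borel_measurable borel" and "0 \<le> \<rho>" and g: "\<And>y. 0 \<le> g y"
    and cross: "\<And>s. 0 < s \<Longrightarrow> g x * g (y + s) \<le> g y * g (x + s)"
  shows "ennreal (g x) * ladder_reward \<rho> g y \<le> ennreal (g y) * ladder_reward \<rho> g x"
proof -
  have "ennreal (g x) * ladder_reward \<rho> g y = (\<integral>\<^sup>+z. ennreal (g x) * reward \<rho> g (traj y) (next_above 0) z \<partial>S)"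
    unfolding ladder_reward_def by (rule nn_integral_cmult[symmetric]) measurable
  also have "\<dots> \<le> (\<integral>\<^sup>+z. ennreal (g y) * reward \<rho> g (traj x) (next_above 0) z \<partial>S)"
  proof (rule nn_integral_mono)
    fix z
    show "ennreal (g x) * reward \<rho> g (traj y) (next_above 0) z \<le>
        ennreal (g y) * reward \<rho> g (traj x) (next_above 0) z"
    proof (cases "next_above 0 z")
      case (enat n)
      then have "0 < (\<Sum>i<n. z i)"
        by (simp add: next_above_def first_time_eq_enat_iff traj_def)
      from mult_left_mono[OF cross[OF this], of "\<rho> ^ n"]
      have "g x * (\<rho> ^ n * g (traj y n z)) \<le> g y * (\<rho> ^ n * g (traj x n z))"
        using \<open>0 \<le> \<rho>\<close> by (simp add: traj_def ac_simps)
      then show ?thesis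
        using enat g by (simp add: reward_def ennreal_mult'[symmetric] ennreal_leI)
    qed (simp add: reward_def)
  qed
  also have "\<dots> = ennreal (g y) * ladder_reward \<rho> g x"
    unfolding ladder_reward_def by (rule nn_integral_cmult) measurable
  finally show ?thesis .
qed

end

text \<open>The stopping region is an abstract upward closed set, so that closed and open half-lines
  are treated at once. Log-concavity is replaced by its consequences on \<open>C\<close>: \<phi>
  \<le> g, and monotonicity of the difference \<open>g - \<phi>\<close>.\<close>

locale monotone_stopping = random_walk \<mu> for \<mu> :: "real measure" +
  fixes \<rho> :: real and g :: "real \<Rightarrow> real" and C :: "real set"
  assumes rho: "0 \<le> \<rho>" "\<rho> \<le> 1"
    and measurable_g [measurable]: "g \<in> borel_measurable borel"
    and g_nonneg: "\<And>y. 0 \<le> g y"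
    and measurable_C [measurable]: "C \<in> sets borel"
    and upward_closed: "\<And>x y. x \<in> C \<Longrightarrow> x \<le> y \<Longrightarrow> y \<in> C"
    and continue: "\<And>y. y \<notin> C \<Longrightarrow> ennreal (g y) \<le> ladder_reward \<rho> g y"
    and stop: "\<And>y. y \<in> C \<Longrightarrow> ladder_reward \<rho> g y \<le> ennreal (g y)"
    and mono_gain_on: "\<And>x y. x \<in> C \<Longrightarrow> x \<le> y \<Longrightarrow>
      ennreal (g x) - ladder_reward \<rho> g x \<le> ennreal (g y) - ladder_reward \<rho> g y"
begin

text \<open>In the notation of the overview, \<open>gain\<close> is \<open>F\<close>,
  \<open>potential\<close> is \<open>W\<close>, and \<open>record_gain n\<close> is the term of
  \<open>W\<close> belonging to time \<open>n\<close>. By \<open>stop\<close> the subtraction is not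
  truncated on \<open>C\<close>.\<close>

definition gain :: "real \<Rightarrow> ennreal" where
  "gain y = (if y \<in> C then ennreal (g y) - ladder_reward \<rho> g y else 0)"

definition record_gain :: "nat \<Rightarrow> real \<Rightarrow> ennreal" where
  "record_gain n y =
     (\<integral>\<^sup>+z. (if is_record n z then ennreal (\<rho> ^ n) * gain (traj y n z) else 0) \<partial>S)"

definition potential :: "real \<Rightarrow> ennreal" where
  "potential y = (\<Sum>n. record_gain n y)"

text \<open>The remainder after iterating up to time \<open>N\<close>: everything is postponed to
  the first record after \<open>N\<close>.\<close>

definition next_reward :: "nat \<Rightarrow> real \<Rightarrow> ennreal" where
  "next_reward N y = (\<integral>\<^sup>+z. reward \<rho> g (traj y) (next_above N) z \<partial>S)"

section \<open>Renewal at the records and iteration along them\<close>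

lemma measurable_gain [measurable]: "gain \<in> borel_measurable borel"
  unfolding gain_def by measurable

lemma measurable_record_gain [measurable]: "record_gain n \<in> borel_measurable borel"
  unfolding record_gain_def by measurable

lemma measurable_potential [measurable]: "potential \<in> borel_measurable borel"
  unfolding potential_def by measurable

text \<open>Given a record at time \<open>N\<close>, the continuation is a fresh path started from
  the record value; its reward at the next ladder epoch is discounted by
  \<open>\<rho> ^ N\<close>.\<close>

lemma nn_integral_reward_record:
  "(\<integral>\<^sup>+z. (if is_record N z then reward \<rho> g (traj y) (next_above N) z else 0) \<partial>S) =
   (\<integral>\<^sup>+z. (if is_record N z then ennreal (\<rho> ^ N) * ladder_reward \<rho> g (traj y N z) else 0) \<partial>S)"
proof -
  have "(\<integral>\<^sup>+z. (if is_record N z then reward \<rho> g (traj y) (next_above N) z else 0) \<partial>S) =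
    (\<integral>\<^sup>+z. \<integral>\<^sup>+z'. (if is_record N (comb_seq N z z') then
      reward \<rho> g (traj y) (next_above N) (comb_seq N z z') else 0) \<partial>S \<partial>S)"
    by (rule nn_integral_comb_seq) measurable
  also have "\<dots> = (\<integral>\<^sup>+z. \<integral>\<^sup>+z'. (if is_record N z then
      ennreal (\<rho> ^ N) * reward \<rho> g (traj (traj y N z)) (next_above 0) z' else 0) \<partial>S \<partial>S)"
  proof (intro nn_integral_cong)
    fix z z'
    have "reward \<rho> g (traj y) (next_above N) (comb_seq N z z') =
        ennreal (\<rho> ^ N) * reward \<rho> g (traj (traj y N z)) (next_above 0) z'" if "is_record N z"
      using rho that by (intro reward_shift) (auto simp: next_above_comb_seq traj_comb_seq)
    then show "(if is_record N (comb_seq N z z') then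
        reward \<rho> g (traj y) (next_above N) (comb_seq N z z') else 0) = (if is_record N z then
        ennreal (\<rho> ^ N) * reward \<rho> g (traj (traj y N z)) (next_above 0) z' else 0)"
      by (simp add: is_record_comb_seq_le)
  qed
  also have "\<dots> = (\<integral>\<^sup>+z. (if is_record N z then ennreal (\<rho> ^ N) * ladder_reward \<rho> g (traj y N z) else 0) \<partial>S)"
    unfolding ladder_reward_def by (intro nn_integral_cong) (auto simp: nn_integral_cmult)
  finally show ?thesis .
qed

lemma next_reward_split:
  "next_reward N y =
     (\<integral>\<^sup>+z. (if is_record (Suc N) z then ennreal (\<rho> ^ Suc N) * ennreal (g (traj y (Suc N) z)) else 0) \<partial>S) +
     (\<integral>\<^sup>+z. (if is_record (Suc N) z then 0 else reward \<rho> g (traj y) (next_above (Suc N)) z) \<partial>S)"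
  unfolding next_reward_def
  by (subst nn_integral_add[symmetric], measurable)
    (intro nn_integral_cong, auto simp: reward_def next_above_Suc[of N] ennreal_mult'[symmetric] rho)

lemma record_gain_add_ladder:
  "record_gain N y + (\<integral>\<^sup>+z. (if is_record N z then reward \<rho> g (traj y) (next_above N) z else 0) \<partial>S) =
   (\<integral>\<^sup>+z. (if is_record N z then ennreal (\<rho> ^ N) * (gain (traj y N z) + ladder_reward \<rho> g (traj y N z)) else 0) \<partial>S)"
  unfolding nn_integral_reward_record record_gain_def
  by (subst nn_integral_add[symmetric], measurable)
    (intro nn_integral_cong, auto simp: distrib_left)

text \<open>As in \<open>next_reward_split\<close>, paths with a record at \<open>Suc N\<close> are
  separated from the others. The parts without a record coincide in both formulas, so comparing
  \<open>next_reward N\<close> with this sum reduces to comparing \<open>g\<close> with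
  \<open>gain + ladder_reward\<close> at the record value.\<close>

lemma next_reward_Suc:
  "next_reward (Suc N) y + record_gain (Suc N) y =
     (\<integral>\<^sup>+z. (if is_record (Suc N) z then ennreal (\<rho> ^ Suc N) *
        (gain (traj y (Suc N) z) + ladder_reward \<rho> g (traj y (Suc N) z)) else 0) \<partial>S) +
     (\<integral>\<^sup>+z. (if is_record (Suc N) z then 0 else reward \<rho> g (traj y) (next_above (Suc N)) z) \<partial>S)"
proof -
  have "next_reward (Suc N) y =
     (\<integral>\<^sup>+z. (if is_record (Suc N) z then reward \<rho> g (traj y) (next_above (Suc N)) z else 0) \<partial>S) +
     (\<integral>\<^sup>+z. (if is_record (Suc N) z then 0 else reward \<rho> g (traj y) (next_above (Suc N)) z) \<partial>S)"
    unfolding next_reward_def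
    by (subst nn_integral_add[symmetric], measurable) (intro nn_integral_cong, auto)
  then show ?thesis
    unfolding record_gain_add_ladder[symmetric] by (simp add: ac_simps)
qed

lemma mono_gain: "x \<le> y \<Longrightarrow> gain x \<le> gain y"
  using mono_gain_on[of x y] upward_closed[of x y] by (auto simp: gain_def)

text \<open>On \<open>C\<close> the inequality \<open>stop\<close> makes the subtraction in
  \<open>gain\<close> reversible; off \<open>C\<close> the gain is 0 and \<open>continue\<close>
  applies.\<close>

lemma reward_le_gain_add_ladder: "ennreal (g y) \<le> gain y + ladder_reward \<rho> g y"
  using stop[of y] continue[of y] by (cases "y \<in> C") (auto simp: gain_def diff_add_cancel_ennreal)

lemma reward_eq_gain_add_ladder: "y \<in> C \<Longrightarrow> ennreal (g y) = gain y + ladder_reward \<rho> g y"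
  using stop[of y] by (auto simp: gain_def diff_add_cancel_ennreal)

lemma record_gain_0: "record_gain 0 y = gain y"
  by (simp add: record_gain_def emeasure_space_1)

lemma reward_le_sum_record_gain:
  "ennreal (g y) \<le> (\<Sum>n\<le>N. record_gain n y) + next_reward N y"
proof (induction N)
  case 0
  then show ?case
    using reward_le_gain_add_ladder[of y]
    by (simp add: record_gain_0 next_reward_def ladder_reward_def)
next
  case (Suc N)
  have "next_reward N y \<le> next_reward (Suc N) y + record_gain (Suc N) y"
    unfolding next_reward_Suc next_reward_split[of N]
    by (intro add_mono nn_integral_mono) (auto intro!: mult_left_mono reward_le_gain_add_ladder)
  then have "(\<Sum>n\<le>N. record_gain n y) + next_reward N y \<le>
      (\<Sum>n\<le>N. record_gain n y) + (next_reward (Suc N) y + record_gain (Suc N) y)"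
    by (rule add_left_mono)
  from order_trans[OF Suc this] show ?case
    by (simp add: ac_simps)
qed

lemma reward_eq_sum_record_gain:
  assumes "y \<in> C"
  shows "ennreal (g y) = (\<Sum>n\<le>N. record_gain n y) + next_reward N y"
proof (induction N)
  case 0
  then show ?case
    using reward_eq_gain_add_ladder[OF assms]
    by (simp add: record_gain_0 next_reward_def ladder_reward_def)
next
  case (Suc N)
  \<comment> \<open>Record values are never below the starting value, so a start in the upward
    closed set \<open>C\<close> keeps all of them in \<open>C\<close>, where the one-step inequality
    is an equality.\<close>
  have "traj y n z \<in> C" if "is_record n z" for n z
  proof (cases n)
    case (Suc m)
    then show ?thesis
      using that upward_closed[OF assms, of "traj y n z"] is_record_iff[of n z y]
      by (auto dest!: spec[of _ 0])
  qed (use assms in simp)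
  then have "next_reward N y = next_reward (Suc N) y + record_gain (Suc N) y"
    unfolding next_reward_Suc next_reward_split[of N]
    by (intro arg_cong2[where f=plus] nn_integral_cong refl)
      (auto simp: reward_eq_gain_add_ladder)
  then show ?case
    using Suc by (simp add: ac_simps)
qed

text \<open>The record sought comes after time \<open>N\<close>, so along a path the reward is
  either 0 or a term of index beyond \<open>N\<close> of a null sequence; the integrable supremum
  dominates.\<close>

lemma next_reward_tendsto_0:
  assumes "(\<integral>\<^sup>+z. (SUP n. ennreal (\<rho> ^ n * g (traj y n z))) \<partial>S) < \<infinity>"
    and "AE z in S. (\<lambda>n. \<rho> ^ n * g (traj y n z)) \<longlonglongrightarrow> 0"
  shows "(\<lambda>N. next_reward N y) \<longlonglongrightarrow> 0"
proof -
  have "(\<lambda>N. next_reward N y) \<longlonglongrightarrow> (\<integral>\<^sup>+z. 0 \<partial>S)"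
    unfolding next_reward_def
  proof (rule nn_integral_dominated_convergence[OF _ _ _ _ assms(1)])
    show "AE z in S. reward \<rho> g (traj y) (next_above N) z \<le> (SUP n. ennreal (\<rho> ^ n * g (traj y n z)))" for N
      by (auto simp: reward_def split: enat.split intro!: SUP_upper)
    show "AE z in S. (\<lambda>N. reward \<rho> g (traj y) (next_above N) z) \<longlonglongrightarrow> 0"
      using assms(2)
    proof eventually_elim
      case (elim z)
      then have lim: "(\<lambda>n. ennreal (\<rho> ^ n * g (traj y n z))) \<longlonglongrightarrow> 0"
        using tendsto_ennrealI by fastforce
      show ?case
      proof (rule order_tendstoI)
        fix a :: ennreal assume "0 < a"
        with lim have "eventually (\<lambda>n. ennreal (\<rho> ^ n * g (traj y n z)) < a) sequentially"
          by (rule order_tendstoD)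
        then obtain K where K: "\<And>n. K \<le> n \<Longrightarrow> ennreal (\<rho> ^ n * g (traj y n z)) < a"
          by (auto simp: eventually_sequentially)
        have "reward \<rho> g (traj y) (next_above N) z < a" if "K \<le> N" for N
        proof (cases "next_above N z")
          case (enat n)
          then have "N < n"
            by (simp add: next_above_def first_time_eq_enat_iff)
          then show ?thesis
            using K[of n] that enat by (simp add: reward_def)
        qed (use \<open>0 < a\<close> in \<open>simp add: reward_def\<close>)
        then show "eventually (\<lambda>N. reward \<rho> g (traj y) (next_above N) z < a) sequentially"
          by (auto simp: eventually_sequentially)
      qed simp
    qed
  qed measurable
  then show ?thesis
    by simp
qed

lemma reward_le_potential:
  assumes lim: "(\<lambda>N. next_reward N y) \<longlonglongrightarrow> 0"
  shows "ennreal (g y) \<le> potential y"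
proof -
  have "(\<lambda>N. (\<Sum>n\<le>N. record_gain n y) + next_reward N y) \<longlonglongrightarrow> potential y + 0"
    unfolding potential_def by (intro tendsto_add summable_LIMSEQ' lim) simp
  then show ?thesis
    using reward_le_sum_record_gain[of y] by (auto intro: LIMSEQ_le_const)
qed

lemma potential_eq_reward:
  assumes "y \<in> C" and lim: "(\<lambda>N. next_reward N y) \<longlonglongrightarrow> 0"
  shows "potential y = ennreal (g y)"
proof -
  have "(\<lambda>N. (\<Sum>n\<le>N. record_gain n y) + next_reward N y) \<longlonglongrightarrow> potential y + 0"
    unfolding potential_def by (intro tendsto_add summable_LIMSEQ' lim) simp
  then show ?thesis
    unfolding reward_eq_sum_record_gain[OF assms(1), symmetric] by (simp add: LIMSEQ_const_iff)
qed

section \<open>Entrance into the stopping region\<close>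

definition record_sum :: "real \<Rightarrow> (nat \<Rightarrow> real) \<Rightarrow> ennreal" where
  "record_sum y z = (\<Sum>n. if is_record n z then ennreal (\<rho> ^ n) * gain (traj y n z) else 0)"

lemma measurable_record_sum [measurable]:
  assumes [measurable]: "f \<in> borel_measurable N" "h \<in> measurable N S"
  shows "(\<lambda>x. record_sum (f x) (h x)) \<in> borel_measurable N"
  unfolding record_sum_def by measurable

lemma potential_eq_record_sum: "potential y = (\<integral>\<^sup>+z. record_sum y z \<partial>S)"
  unfolding potential_def record_gain_def record_sum_def
  by (rule nn_integral_suminf[symmetric]) measurable

lemma gain_outside: "y \<notin> C \<Longrightarrow> gain y = 0"
  by (simp add: gain_def)

text \<open>Before its entrance the path is outside \<open>C\<close> and hence, by upward closure,
  below every point of \<open>C\<close>. Among the times with values in \<open>C\<close>, the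
  records of the whole path are therefore those of the path restarted at the entrance.\<close>

lemma record_sum_comb_seq:
  assumes hit: "hit C y z = enat m"
  shows "record_sum y (comb_seq m z z') = ennreal (\<rho> ^ m) * record_sum (traj y m z) z'"
proof -
  let ?z = "comb_seq m z z'"
  have before: "traj y j ?z \<notin> C" if "j < m" for j
    using hit that by (simp add: hit_def first_time_eq_enat_iff traj_comb_seq_le)
  have "record_sum y ?z = (\<Sum>k. if is_record (m + k) ?z then
      ennreal (\<rho> ^ (m + k)) * gain (traj y (m + k) ?z) else 0)"
    unfolding record_sum_def
    by (rule ennreal_suminf_shift) (simp add: before gain_outside)
  also have "\<dots> = (\<Sum>k. ennreal (\<rho> ^ m) * (if is_record k z' then
      ennreal (\<rho> ^ k) * gain (traj (traj y m z) k z') else 0))"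
  proof (rule suminf_cong)
    fix k
    \<comment> \<open>Off \<open>C\<close> both terms of the sums vanish, so the equivalence is only
      wanted for values in \<open>C\<close>.\<close>
    have "is_record (m + k) ?z \<longleftrightarrow> is_record k z'" if C: "traj y (m + k) ?z \<in> C"
    proof
      assume "is_record k z'"
      then have after: "traj y (m + i) ?z < traj y (m + k) ?z" if "i < k" for i
        using that is_record_iff[of k z' "traj y m z"] by (simp add: traj_comb_seq)
      have "traj y j ?z < traj y (m + k) ?z" if "j < m + k" for j
      proof (cases "j < m")
        case True
        then show ?thesis
          using before[of j] C upward_closed by (meson not_less)
      next
        case False
        then show ?thesis
          using after[of "j - m"] that by simp
      qed
      then show "is_record (m + k) ?z"
        by (simp add: is_record_iff[of _ _ y])
    next
      assume *: "is_record (m + k) ?z"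
      have "traj y (m + i) ?z < traj y (m + k) ?z" if "i < k" for i
        using * that by (simp add: is_record_iff[of _ _ y])
      then show "is_record k z'"
        by (simp add: is_record_iff[of k z' "traj y m z"] traj_comb_seq)
    qed
    then show "(if is_record (m + k) ?z then ennreal (\<rho> ^ (m + k)) * gain (traj y (m + k) ?z) else 0) =
        ennreal (\<rho> ^ m) * (if is_record k z' then ennreal (\<rho> ^ k) * gain (traj (traj y m z) k z') else 0)"
      using rho by (cases "traj y (m + k) ?z \<in> C")
        (auto simp: traj_comb_seq gain_outside power_add ennreal_mult' mult.assoc)
  qed
  also have "\<dots> = ennreal (\<rho> ^ m) * record_sum (traj y m z) z'"
    unfolding record_sum_def by simp
  finally show ?thesis .
qed

text \<open>For entrance at time \<open>m\<close>, the restarted record sum integrates to the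
  potential at the entrance point, which is \<open>g\<close> there. Paths that never enter
  \<open>C\<close> have record sum 0 and reward 0.\<close>

lemma potential_eq_hit_reward:
  assumes eq: "\<And>y. y \<in> C \<Longrightarrow> potential y = ennreal (g y)"
  shows "potential y = (\<integral>\<^sup>+z. reward \<rho> g (traj y) (hit C y) z \<partial>S)"
proof -
  have "potential y = (\<integral>\<^sup>+z. (\<Sum>m. if hit C y z = enat m then record_sum y z else 0) \<partial>S)"
    unfolding potential_eq_record_sum
  proof (rule nn_integral_cong)
    fix z
    show "record_sum y z = (\<Sum>m. if hit C y z = enat m then record_sum y z else 0)"
    proof (cases "hit C y z")
      case (enat m)
      then have "(\<lambda>m. if hit C y z = enat m then record_sum y z else 0) =
          (\<lambda>r. if r = m then record_sum y z else 0)"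
        by auto
      then show ?thesis
        using sums_unique[OF sums_single[of m "\<lambda>_. record_sum y z"]] by simp
    next
      case infinity
      then have "traj y n z \<notin> C" for n
        by (simp add: hit_def first_time_eq_infinity_iff)
      then show ?thesis
        using infinity by (simp add: record_sum_def gain_outside cong: if_cong)
    qed
  qed
  also have "\<dots> = (\<Sum>m. \<integral>\<^sup>+z. (if hit C y z = enat m then record_sum y z else 0) \<partial>S)"
    by (rule nn_integral_suminf) measurable
  also have "\<dots> = (\<Sum>m. \<integral>\<^sup>+z. (if hit C y z = enat m then ennreal (\<rho> ^ m * g (traj y m z)) else 0) \<partial>S)"
  proof (rule suminf_cong)
    fix m
    have "(\<integral>\<^sup>+z. (if hit C y z = enat m then record_sum y z else 0) \<partial>S) =
      (\<integral>\<^sup>+z. \<integral>\<^sup>+z'. (if hit C y (comb_seq m z z') = enat m then record_sum y (comb_seq m z z') else 0) \<partial>S \<partial>S)"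
      by (rule nn_integral_comb_seq) measurable
    also have "\<dots> = (\<integral>\<^sup>+z. (if hit C y z = enat m then ennreal (\<rho> ^ m) * potential (traj y m z) else 0) \<partial>S)"
      by (intro nn_integral_cong)
        (auto simp: hit_comb_seq_eq record_sum_comb_seq potential_eq_record_sum nn_integral_cmult cong: if_cong)
    also have "\<dots> = (\<integral>\<^sup>+z. (if hit C y z = enat m then ennreal (\<rho> ^ m * g (traj y m z)) else 0) \<partial>S)"
      using rho by (intro nn_integral_cong)
        (auto simp: hit_def first_time_eq_enat_iff eq ennreal_mult')
    finally show "(\<integral>\<^sup>+z. (if hit C y z = enat m then record_sum y z else 0) \<partial>S) =
        (\<integral>\<^sup>+z. (if hit C y z = enat m then ennreal (\<rho> ^ m * g (traj y m z)) else 0) \<partial>S)" .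
  qed
  also have "\<dots> = (\<integral>\<^sup>+z. reward \<rho> g (traj y) (hit C y) z \<partial>S)"
    unfolding reward_eq_suminf by (rule nn_integral_suminf[symmetric]) measurable
  finally show ?thesis .
qed

lemma potential_excessive:
  "ennreal \<rho> * (\<integral>\<^sup>+x. potential (y + x) \<partial>\<mu>) \<le> potential y"
proof -
  define c where "c n = (\<integral>\<^sup>+x. \<integral>\<^sup>+z. (if is_record n z \<and> traj x n z \<le> 0 then 1 else 0) \<partial>S \<partial>\<mu> :: ennreal)" for n
  \<comment> \<open>Put the increment \<open>x\<close> in front of the path \<open>z\<close>. A
    record \<open>n\<close> of \<open>z\<close> is either above the original start, and then is the
    record \<open>Suc n\<close> of the longer path, or it is not, and then its discounted gain is at
    most \<open>gain y\<close> by monotonicity. The probability of the latter case is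
    \<open>c n\<close>.\<close>
  have step: "ennreal \<rho> * (\<integral>\<^sup>+x. record_gain n (y + x) \<partial>\<mu>) \<le> record_gain (Suc n) y + gain y * c n" for n
  proof -
    let ?h = "\<lambda>x z. if is_record n z \<and> 0 < traj x n z then
      ennreal (\<rho> ^ Suc n) * gain (traj (y + x) n z) else 0"
    have "ennreal \<rho> * (\<integral>\<^sup>+x. record_gain n (y + x) \<partial>\<mu>) = (\<integral>\<^sup>+x. \<integral>\<^sup>+z. ennreal \<rho> *
        (if is_record n z then ennreal (\<rho> ^ n) * gain (traj (y + x) n z) else 0) \<partial>S \<partial>\<mu>)"
      unfolding record_gain_def by (simp add: nn_integral_cmult)
    also have "\<dots> \<le> (\<integral>\<^sup>+x. \<integral>\<^sup>+z. ?h x z +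
        gain y * (if is_record n z \<and> traj x n z \<le> 0 then 1 else 0) \<partial>S \<partial>\<mu>)"
    proof (intro nn_integral_mono)
      fix x z
      have "traj (y + x) n z = y + traj x n z"
        by (simp add: traj_def)
      moreover have "ennreal \<rho> * (ennreal (\<rho> ^ n) * gain (y + traj x n z)) \<le> gain y" if "traj x n z \<le> 0"
      proof -
        have "ennreal \<rho> * (ennreal (\<rho> ^ n) * gain (y + traj x n z)) = ennreal (\<rho> ^ Suc n) * gain (y + traj x n z)"
          using rho by (simp add: ennreal_mult' mult.assoc)
        also have "\<dots> \<le> 1 * gain y"
          using rho that power_le_one[OF rho, of "Suc n"] by (intro mult_mono mono_gain) auto
        finally show ?thesis
          by simp
      qed
      ultimately show "ennreal \<rho> * (if is_record n z then ennreal (\<rho> ^ n) * gain (traj (y + x) n z) else 0)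
          \<le> ?h x z + gain y * (if is_record n z \<and> traj x n z \<le> 0 then 1 else 0)"
        using rho by (auto simp: not_less ennreal_mult' mult.assoc)
    qed
    also have "\<dots> = (\<integral>\<^sup>+x. \<integral>\<^sup>+z. ?h x z \<partial>S \<partial>\<mu>) + gain y * c n"
      unfolding c_def by (simp add: nn_integral_add nn_integral_cmult)
    also have "(\<integral>\<^sup>+x. \<integral>\<^sup>+z. ?h x z \<partial>S \<partial>\<mu>) = record_gain (Suc n) y"
      unfolding record_gain_def
      by (rule sym, subst nn_integral_case_nat) (auto simp: is_record_Suc_case_nat traj_Suc_case_nat cong: if_cong)
    finally show ?thesis .
  qed
  have "ennreal \<rho> * (\<integral>\<^sup>+x. potential (y + x) \<partial>\<mu>) = (\<Sum>n. ennreal \<rho> * (\<integral>\<^sup>+x. record_gain n (y + x) \<partial>\<mu>))"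
    unfolding potential_def by (simp add: nn_integral_suminf)
  also have "\<dots> \<le> (\<Sum>n. record_gain (Suc n) y + gain y * c n)"
    by (intro suminf_le step) auto
  also have "\<dots> = (\<Sum>n. record_gain (Suc n) y) + gain y * (\<Sum>n. c n)"
    by (simp add: suminf_add[symmetric])
  \<comment> \<open>Since the \<open>c n\<close> sum to at most 1, one copy of \<open>gain y\<close>
    remains, and this is the missing term of index 0 of the potential.\<close>
  also have "\<dots> \<le> (\<Sum>n. record_gain (Suc n) y) + gain y * 1"
    unfolding c_def by (intro add_left_mono mult_left_mono suminf_weak_record_le_1) auto
  also have "\<dots> = potential y"
    using suminf_offset[of "\<lambda>n. record_gain n y" 1] by (simp add: potential_def record_gain_0 add.commute)
  finally show ?thesis .
qed

end

section \<open>Random walks adapted to a filtration\<close>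

lemma (in prob_space) nn_integral_indep_var:
  assumes indep: "indep_var borel U borel (Y :: 'a \<Rightarrow> real)"
    and f [measurable]: "f \<in> borel_measurable (borel \<Otimes>\<^sub>M borel)"
  shows "(\<integral>\<^sup>+\<omega>. f (Y \<omega>, U \<omega>) \<partial>M) = (\<integral>\<^sup>+\<omega>. \<integral>\<^sup>+x. f (Y \<omega>, x) \<partial>distr M borel U \<partial>M)"
proof -
  have [measurable]: "random_variable borel U" "random_variable borel Y"
    using indep_var_rv1[OF indep] indep_var_rv2[OF indep] .
  interpret U: prob_space "distr M borel U"
    by (rule prob_space_distr) measurable
  interpret Y: prob_space "distr M borel Y"
    by (rule prob_space_distr) measurable
  interpret YU: pair_sigma_finite "distr M borel U" "distr M borel Y" ..
  have "(\<integral>\<^sup>+\<omega>. f (Y \<omega>, U \<omega>) \<partial>M) = (\<integral>\<^sup>+p. f (snd p, fst p) \<partial>distr M (borel \<Otimes>\<^sub>M borel) (\<lambda>\<omega>. (U \<omega>, Y \<omega>)))"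
    by (subst nn_integral_distr) auto
  also have "\<dots> = (\<integral>\<^sup>+p. f (snd p, fst p) \<partial>(distr M borel U \<Otimes>\<^sub>M distr M borel Y))"
    using indep by (simp add: indep_var_distribution_eq)
  also have "\<dots> = (\<integral>\<^sup>+y. \<integral>\<^sup>+x. f (y, x) \<partial>distr M borel U \<partial>distr M borel Y)"
    by (subst YU.nn_integral_snd[symmetric]) auto
  also have "\<dots> = (\<integral>\<^sup>+\<omega>. \<integral>\<^sup>+x. f (Y \<omega>, x) \<partial>distr M borel U \<partial>M)"
    by (subst nn_integral_distr) auto
  finally show ?thesis .
qed

section \<open>Transfer to the space of increment sequences\<close>

locale iid_walk = prob_space M for M :: "'a measure" +
  fixes X :: "nat \<Rightarrow> 'a \<Rightarrow> real"
  assumes iid: "iid_increments M X"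
begin

definition step :: "real measure" where "step = distr M borel (X 1)"

lemma indep_vars_X: "indep_vars (\<lambda>_. borel) X {1..}"
  using iid unfolding iid_increments_def by (rule conjunct1)

lemma distr_X: "distr M borel (X (Suc n)) = step"
  using iid unfolding iid_increments_def step_def by (metis le_add1 plus_1_eq_Suc)

lemma measurable_X: "1 \<le> i \<Longrightarrow> X i \<in> borel_measurable M"
  using indep_vars_X unfolding indep_vars_def2 by auto

sublocale step: prob_space step
  unfolding step_def by (rule prob_space_distr) (simp add: measurable_X)

sublocale steps: random_walk step
  by unfold_locales (simp add: step_def)

lemma walk_eq_traj: "walk X y n \<omega> = traj y n (\<lambda>i. X (Suc i) \<omega>)"
  by (simp add: walk_def psum_def traj_def sum.atLeast1_atMost_eq)

lemma measurable_walk [measurable]: "walk X y n \<in> borel_measurable M"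
  unfolding walk_def psum_def by (intro borel_measurable_add borel_measurable_sum measurable_X) auto

lemma measurable_shifted_X [measurable]: "(\<lambda>\<omega> i. X (Suc i) \<omega>) \<in> measurable M steps.S"
proof -
  have "X (Suc i) \<in> measurable M step" for i
    using measurable_X[of "Suc i"] by (simp add: step_def)
  then show ?thesis
    by (intro measurable_PiM_single') (auto simp: space_PiM step_def)
qed

text \<open>Independence gives the product law over the indices \<open>{1..}\<close>; reindexing by
  \<open>Suc\<close> and the equality of the marginals turn it into the infinite power of
  \<open>step\<close>.\<close>

lemma distr_increments: "distr M steps.S (\<lambda>\<omega> i. X (Suc i) \<omega>) = steps.S"
proof -
  let ?P = "\<Pi>\<^sub>M i\<in>{1..}. distr M borel (X i)"
  have P: "distr M (\<Pi>\<^sub>M i\<in>{1..}. borel) (\<lambda>\<omega>. \<lambda>i\<in>{1..}. X i \<omega>) = ?P"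
    by (rule indep_vars_iff_distr_eq_PiM'[THEN iffD1, OF _ _ indep_vars_X]) (auto simp: measurable_X)
  have "steps.S = distr ?P (\<Pi>\<^sub>M i\<in>UNIV. distr M borel (X (Suc i))) (\<lambda>\<omega>. \<lambda>n\<in>UNIV. \<omega> (Suc n))"
    using distr_PiM_reindex[of "{1..}" "\<lambda>i. distr M borel (X i)" Suc UNIV]
    by (simp add: distr_X prob_space_distr measurable_X)
  also have "\<dots> = distr (distr M (\<Pi>\<^sub>M i\<in>{1..}. borel) (\<lambda>\<omega>. \<lambda>i\<in>{1..}. X i \<omega>)) steps.S (\<lambda>\<omega> n. \<omega> (Suc n))"
    unfolding P by (simp add: distr_X restrict_def)
  also have "\<dots> = distr M steps.S ((\<lambda>\<omega> n. \<omega> (Suc n)) \<circ> (\<lambda>\<omega>. \<lambda>i\<in>{1..}. X i \<omega>))"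
  proof (rule distr_distr)
    show "(\<lambda>\<omega> n. \<omega> (Suc n)) \<in> measurable (\<Pi>\<^sub>M i\<in>{1..}. borel) steps.S"
      by (intro measurable_PiM_single') (auto simp: space_PiM step_def)
    show "(\<lambda>\<omega>. \<lambda>i\<in>{1..}. X i \<omega>) \<in> measurable M (\<Pi>\<^sub>M i\<in>{1..}. borel)"
      by (intro measurable_restrict) (auto simp: measurable_X)
  qed
  also have "\<dots> = distr M steps.S (\<lambda>\<omega> i. X (Suc i) \<omega>)"
    by (simp add: comp_def)
  finally show ?thesis ..
qed

lemma nn_integral_increments:
  assumes [measurable]: "f \<in> borel_measurable steps.S"
  shows "(\<integral>\<^sup>+\<omega>. f (\<lambda>i. X (Suc i) \<omega>) \<partial>M) = (\<integral>\<^sup>+z. f z \<partial>steps.S)"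
proof -
  have "(\<integral>\<^sup>+z. f z \<partial>steps.S) = (\<integral>\<^sup>+z. f z \<partial>distr M steps.S (\<lambda>\<omega> i. X (Suc i) \<omega>))"
    by (simp only: distr_increments)
  then show ?thesis
    by (simp add: nn_integral_distr)
qed

lemma AE_increments:
  assumes [measurable]: "Measurable.pred steps.S P" and "AE \<omega> in M. P (\<lambda>i. X (Suc i) \<omega>)"
  shows "AE z in steps.S. P z"
  using assms(2) by (subst distr_increments[symmetric]) (simp add: AE_distr_iff)

section \<open>One step of the walk relative to the filtration\<close>

lemma indep_step: "indep_var borel (X (Suc n)) borel (walk X y n)"
proof -
  have "indep_vars (\<lambda>_. borel) X (insert (Suc n) {1..n})"
    by (rule indep_vars_subset[OF indep_vars_X]) auto
  then have "indep_var borel (X (Suc n)) borel (\<lambda>\<omega>. \<Sum>i\<in>{1..n}. X i \<omega>)"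
    by (intro indep_vars_sum) auto
  then have "indep_var borel (id \<circ> X (Suc n)) borel ((\<lambda>s. y + s) \<circ> (\<lambda>\<omega>. \<Sum>i\<in>{1..n}. X i \<omega>))"
    by (rule indep_var_compose) auto
  then show ?thesis
    by (simp add: comp_def walk_def[abs_def] psum_def)
qed

lemma walk_Suc: "walk X y (Suc n) \<omega> = walk X y n \<omega> + X (Suc n) \<omega>"
  by (simp add: walk_def psum_def)

lemma nn_integral_walk_step_indicator:
  assumes markov: "markov_process M A (walk X y)" and D: "D \<in> sets (A n)" and B: "B \<in> sets borel"
  shows "(\<integral>\<^sup>+\<omega>. indicator D \<omega> * indicator B (walk X y (Suc n) \<omega>) \<partial>M) =
    (\<integral>\<^sup>+\<omega>. indicator D \<omega> * (\<integral>\<^sup>+x. indicator B (walk X y n \<omega> + x) \<partial>step) \<partial>M)"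
proof -
  let ?Y = "walk X y n" and ?f = "\<lambda>\<omega>. indicator B (walk X y (Suc n) \<omega>) :: real"
  let ?G = "vimage_algebra (space M) ?Y borel"
  \<comment> \<open>The transition probability as a real number, since \<open>real_cond_exp\<close>
    is real-valued; its values lie between 0 and 1, so integrals can be converted back and
    forth.\<close>
  define k where "k u = enn2real (\<integral>\<^sup>+x. indicator B (u + x) \<partial>step)" for u :: real
  have [measurable]: "B \<in> sets borel"
    by (rule B)
  have [measurable]: "k \<in> borel_measurable borel"
    unfolding k_def[abs_def] by measurable
  have le_1: "(\<integral>\<^sup>+x. indicator B (u + x) \<partial>step) \<le> 1" for u
  proof -
    have "(\<integral>\<^sup>+x. indicator B (u + x) \<partial>step) \<le> (\<integral>\<^sup>+x. 1 \<partial>step)"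
      by (intro nn_integral_mono) (auto split: split_indicator)
    then show ?thesis
      by (simp add: step.emeasure_space_1)
  qed
  have k: "ennreal (k u) = (\<integral>\<^sup>+x. indicator B (u + x) \<partial>step)" for u
    unfolding k_def using le_1[of u] by (intro ennreal_enn2real) (auto intro: le_less_trans)
  have k0: "0 \<le> k u" "k u \<le> 1" for u
    using le_1[of u] by (auto simp: k_def enn2real_leI)
  have subA: "subalgebra M (A n)"
    using markov by (simp add: markov_process_def)
  have subG: "subalgebra M ?G"
    by (auto simp: subalgebra_def sets_vimage_algebra2)
  interpret FA: finite_measure_subalgebra M "A n"
    by unfold_locales (rule subA)
  interpret FG: finite_measure_subalgebra M ?G
    by unfold_locales (rule subG)
  have [measurable]: "D \<in> sets M"
    using D subA by (auto simp: subalgebra_def)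
  have int_f: "integrable M ?f"
    by (rule integrable_const_bound[where B=1]) auto
  have int_k: "integrable M (\<lambda>\<omega>. k (?Y \<omega>))"
    by (rule integrable_const_bound[where B=1]) (auto simp: k0)
  \<comment> \<open>The sets of \<open>?G\<close> are the preimages of Borel sets \<open>E'\<close>
    under the position, so the kernel is tested on them by independence and Fubini.\<close>
  have eqG: "AE \<omega> in M. real_cond_exp M ?G ?f \<omega> = k (?Y \<omega>)"
  proof (rule FG.real_cond_exp_charact[OF _ int_f int_k])
    fix E assume "E \<in> sets ?G"
    then obtain E' where E' [measurable]: "E' \<in> sets borel" and E: "E = ?Y -` E' \<inter> space M"
      by (auto simp: sets_vimage_algebra2)
    have [measurable]: "E \<in> sets M"
      unfolding E by measurable
    have "(\<integral>\<^sup>+\<omega>. ennreal (indicator E \<omega> * ?f \<omega>) \<partial>M) =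
        (\<integral>\<^sup>+\<omega>. (\<lambda>(u, x). indicator E' u * indicator B (u + x)) (?Y \<omega>, X (Suc n) \<omega>) \<partial>M)"
      by (intro nn_integral_cong) (auto simp: E walk_Suc split: split_indicator)
    also have "\<dots> = (\<integral>\<^sup>+\<omega>. \<integral>\<^sup>+x. indicator E' (?Y \<omega>) * indicator B (?Y \<omega> + x) \<partial>step \<partial>M)"
      by (subst nn_integral_indep_var[OF indep_step]) (auto simp: distr_X)
    also have "\<dots> = (\<integral>\<^sup>+\<omega>. ennreal (indicator E \<omega> * k (?Y \<omega>)) \<partial>M)"
    proof (intro nn_integral_cong)
      fix \<omega> assume "\<omega> \<in> space M"
      have "(\<integral>\<^sup>+x. indicator E' (?Y \<omega>) * indicator B (?Y \<omega> + x) \<partial>step) =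
          indicator E' (?Y \<omega>) * ennreal (k (?Y \<omega>))"
        unfolding k by (rule nn_integral_cmult) measurable
      then show "(\<integral>\<^sup>+x. indicator E' (?Y \<omega>) * indicator B (?Y \<omega> + x) \<partial>step) =
          ennreal (indicator E \<omega> * k (?Y \<omega>))"
        using \<open>\<omega> \<in> space M\<close> by (auto simp: E split: split_indicator)
    qed
    finally show "(\<integral>\<omega>\<in>E. ?f \<omega> \<partial>M) = (\<integral>\<omega>\<in>E. k (?Y \<omega>) \<partial>M)"
      unfolding set_lebesgue_integral_def by (simp add: integral_eq_nn_integral k0)
  next
    have "?Y \<in> measurable ?G borel"
      by (rule measurable_vimage_algebra1) simp
    then show "(\<lambda>\<omega>. k (?Y \<omega>)) \<in> borel_measurable ?G"
      by measurable
  qed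
  have "AE \<omega> in M. real_cond_exp M (A n) ?f \<omega> = real_cond_exp M ?G ?f \<omega>"
    using markov B by (simp add: markov_process_def)
  with eqG have eqA: "AE \<omega> in M. real_cond_exp M (A n) ?f \<omega> = k (?Y \<omega>)"
    by eventually_elim simp
  have "(\<integral>\<omega>\<in>D. ?f \<omega> \<partial>M) = (\<integral>\<omega>\<in>D. real_cond_exp M (A n) ?f \<omega> \<partial>M)"
    by (rule FA.real_cond_exp_intA[OF int_f D])
  also have "\<dots> = (\<integral>\<omega>\<in>D. k (?Y \<omega>) \<partial>M)"
    unfolding set_lebesgue_integral_def using eqA by (intro integral_cong_AE) auto
  finally have "ennreal (\<integral>\<omega>. indicator D \<omega> * ?f \<omega> \<partial>M) = ennreal (\<integral>\<omega>. indicator D \<omega> * k (?Y \<omega>) \<partial>M)"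
    by (simp add: set_lebesgue_integral_def)
  moreover have "ennreal (\<integral>\<omega>. indicator D \<omega> * ?f \<omega> \<partial>M) = (\<integral>\<^sup>+\<omega>. ennreal (indicator D \<omega> * ?f \<omega>) \<partial>M)"
    by (rule nn_integral_eq_integral[symmetric])
      (auto intro!: integrable_const_bound[where B=1] split: split_indicator)
  moreover have "ennreal (\<integral>\<omega>. indicator D \<omega> * k (?Y \<omega>) \<partial>M) = (\<integral>\<^sup>+\<omega>. ennreal (indicator D \<omega> * k (?Y \<omega>)) \<partial>M)"
    by (rule nn_integral_eq_integral[symmetric])
      (auto intro!: integrable_const_bound[where B=1] simp: k0 split: split_indicator)
  ultimately show ?thesis
    unfolding k[symmetric] by (simp add: ennreal_mult' ennreal_indicator k0)
qed

text \<open>Both sides are integrals of \<open>h\<close> against measures on the line, namely laws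
  under \<open>M\<close> restricted to \<open>D\<close>; these agree on Borel sets by the indicator
  case.\<close>

lemma nn_integral_walk_step:
  assumes markov: "markov_process M A (walk X y)" and D: "D \<in> sets (A n)"
    and h [measurable]: "h \<in> borel_measurable borel"
  shows "(\<integral>\<^sup>+\<omega>. indicator D \<omega> * h (walk X y (Suc n) \<omega>) \<partial>M) =
    (\<integral>\<^sup>+\<omega>. indicator D \<omega> * (\<integral>\<^sup>+x. h (walk X y n \<omega> + x) \<partial>step) \<partial>M)"
proof -
  have [measurable]: "D \<in> sets M"
    using D markov by (auto simp: markov_process_def subalgebra_def)
  let ?D = "density M (indicator D)"
  let ?N1 = "distr ?D borel (walk X y (Suc n))"
  let ?N2 = "distr (?D \<Otimes>\<^sub>M step) borel (\<lambda>(\<omega>, x). walk X y n \<omega> + x)"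
  have N1: "(\<integral>\<^sup>+u. h u \<partial>?N1) = (\<integral>\<^sup>+\<omega>. indicator D \<omega> * h (walk X y (Suc n) \<omega>) \<partial>M)"
    if [measurable]: "h \<in> borel_measurable borel" for h
    by (simp add: nn_integral_distr nn_integral_density)
  have N2: "(\<integral>\<^sup>+u. h u \<partial>?N2) = (\<integral>\<^sup>+\<omega>. indicator D \<omega> * (\<integral>\<^sup>+x. h (walk X y n \<omega> + x) \<partial>step) \<partial>M)"
    if [measurable]: "h \<in> borel_measurable borel" for h
  proof -
    have "(\<integral>\<^sup>+u. h u \<partial>?N2) = (\<integral>\<^sup>+p. h (walk X y n (fst p) + snd p) \<partial>(?D \<Otimes>\<^sub>M step))"
      by (subst nn_integral_distr) (auto simp: split_beta')
    also have "\<dots> = (\<integral>\<^sup>+\<omega>. \<integral>\<^sup>+x. h (walk X y n \<omega> + x) \<partial>step \<partial>?D)"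
      by (subst step.nn_integral_fst[symmetric]) auto
    also have "\<dots> = (\<integral>\<^sup>+\<omega>. indicator D \<omega> * (\<integral>\<^sup>+x. h (walk X y n \<omega> + x) \<partial>step) \<partial>M)"
      by (simp add: nn_integral_density)
    finally show ?thesis .
  qed
  have "?N1 = ?N2"
  proof (rule measure_eqI)
    fix B assume "B \<in> sets ?N1"
    then have [measurable]: "B \<in> sets borel"
      by simp
    have "emeasure ?N1 B = (\<integral>\<^sup>+u. indicator B u \<partial>?N1)"
      by simp
    also have "\<dots> = (\<integral>\<^sup>+u. indicator B u \<partial>?N2)"
      by (simp only: N1 N2 borel_measurable_indicator \<open>B \<in> sets borel\<close>
          nn_integral_walk_step_indicator[OF markov D])
    finally show "emeasure ?N1 B = emeasure ?N2 B"
      by simp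
  qed simp
  then show ?thesis
    using N1[OF h] N2[OF h] by simp
qed

text \<open>A supermartingale argument written with nonnegative integrals, which allows infinite
  values of \<open>U\<close>: the part already stopped plus the part still running never grows in
  time, and it starts at \<open>U y\<close>.\<close>

lemma reward_le_excessive:
  assumes markov: "markov_process M A (walk X y)" and tau: "stop_time M A \<tau>"
    and rho: "0 \<le> \<rho>" and U [measurable]: "U \<in> borel_measurable borel"
    and excessive: "\<And>y. ennreal \<rho> * (\<integral>\<^sup>+x. U (y + x) \<partial>step) \<le> U y"
    and dominates: "\<And>y. ennreal (g y) \<le> U y"
    and [measurable]: "g \<in> borel_measurable borel"
  shows "(\<integral>\<^sup>+\<omega>. reward \<rho> g (walk X y) \<tau> \<omega> \<partial>M) \<le> U y"
proof -
  have sub: "subalgebra M (A n)" for n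
    using markov by (simp add: markov_process_def)
  have pred_A: "Measurable.pred (A n) (\<lambda>\<omega>. enat n < \<tau> \<omega>)" for n
    using stopping_timeD2[of "case_enat A M" \<tau> "enat n"] tau by (simp add: stop_time_def)
  have [measurable]: "Measurable.pred M (\<lambda>\<omega>. enat n < \<tau> \<omega>)" for n
    using measurable_from_subalg[OF sub pred_A] .
  have [measurable]: "Measurable.pred M (\<lambda>\<omega>. \<tau> \<omega> = enat n)" for n
  proof (cases n)
    case 0
    have "(\<lambda>\<omega>. \<tau> \<omega> = enat 0) = (\<lambda>\<omega>. \<not> enat 0 < \<tau> \<omega>)"
      by (auto simp: zero_enat_def[symmetric])
    then show ?thesis
      unfolding 0 by simp
  next
    case (Suc m)
    have "\<tau> \<omega> = enat (Suc m) \<longleftrightarrow> enat m < \<tau> \<omega> \<and> \<not> enat (Suc m) < \<tau> \<omega>" for \<omega>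
      by (cases "\<tau> \<omega>") auto
    then show ?thesis
      unfolding Suc by simp
  qed
  \<comment> \<open>\<open>a n\<close> is the discounted \<open>U\<close> collected by stopping
    exactly at \<open>n\<close>; \<open>r n\<close> is what the paths not yet stopped by then
    carry.\<close>
  define a where "a n = (\<integral>\<^sup>+\<omega>. (if \<tau> \<omega> = enat n then ennreal (\<rho> ^ n) * U (walk X y n \<omega>) else 0) \<partial>M)" for n
  define r where "r n = (\<integral>\<^sup>+\<omega>. (if enat n < \<tau> \<omega> then ennreal (\<rho> ^ n) * U (walk X y n \<omega>) else 0) \<partial>M)" for n
  have r_Suc: "a (Suc n) + r (Suc n) \<le> r n" for n
  proof -
    let ?D = "{\<omega> \<in> space M. enat n < \<tau> \<omega>}"
    \<comment> \<open>Not having stopped by time \<open>n\<close> is an event of \<open>A n\<close>,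
      which is what permits the one-step formula.\<close>
    have D: "?D \<in> sets (A n)"
      using pred_A[of n] sub[of n] by (simp add: Measurable.pred_def subalgebra_def)
    have "a (Suc n) + r (Suc n) = (\<integral>\<^sup>+\<omega>. ennreal (\<rho> ^ Suc n) * (indicator ?D \<omega> * U (walk X y (Suc n) \<omega>)) \<partial>M)"
      unfolding a_def r_def
    proof (subst nn_integral_add[symmetric], measurable, intro nn_integral_cong)
      fix \<omega> assume "\<omega> \<in> space M"
      then show "(if \<tau> \<omega> = enat (Suc n) then ennreal (\<rho> ^ Suc n) * U (walk X y (Suc n) \<omega>) else 0) +
          (if enat (Suc n) < \<tau> \<omega> then ennreal (\<rho> ^ Suc n) * U (walk X y (Suc n) \<omega>) else 0) =
          ennreal (\<rho> ^ Suc n) * (indicator ?D \<omega> * U (walk X y (Suc n) \<omega>))"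
        by (cases "\<tau> \<omega>") (auto split: split_indicator)
    qed
    also have "\<dots> = ennreal (\<rho> ^ Suc n) * (\<integral>\<^sup>+\<omega>. indicator ?D \<omega> * U (walk X y (Suc n) \<omega>) \<partial>M)"
      by (rule nn_integral_cmult) measurable
    also have "\<dots> = ennreal (\<rho> ^ Suc n) * (\<integral>\<^sup>+\<omega>. indicator ?D \<omega> * (\<integral>\<^sup>+x. U (walk X y n \<omega> + x) \<partial>step) \<partial>M)"
      by (simp only: nn_integral_walk_step[OF markov D U])
    also have "\<dots> = (\<integral>\<^sup>+\<omega>. ennreal (\<rho> ^ Suc n) * (indicator ?D \<omega> * (\<integral>\<^sup>+x. U (walk X y n \<omega> + x) \<partial>step)) \<partial>M)"
      by (rule nn_integral_cmult[symmetric]) measurable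
    also have "\<dots> \<le> r n"
      unfolding r_def
    proof (intro nn_integral_mono)
      fix \<omega> assume "\<omega> \<in> space M"
      have "ennreal (\<rho> ^ Suc n) * (\<integral>\<^sup>+x. U (walk X y n \<omega> + x) \<partial>step) =
          ennreal (\<rho> ^ n) * (ennreal \<rho> * (\<integral>\<^sup>+x. U (walk X y n \<omega> + x) \<partial>step))"
        using rho by (simp add: ennreal_mult' ac_simps)
      also have "\<dots> \<le> ennreal (\<rho> ^ n) * U (walk X y n \<omega>)"
        by (intro mult_left_mono excessive) simp
      finally show "ennreal (\<rho> ^ Suc n) * (indicator ?D \<omega> * (\<integral>\<^sup>+x. U (walk X y n \<omega> + x) \<partial>step)) \<le>
          (if enat n < \<tau> \<omega> then ennreal (\<rho> ^ n) * U (walk X y n \<omega>) else 0)"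
        by (auto split: split_indicator)
    qed
    finally show ?thesis .
  qed
  have "(\<Sum>m<Suc n. a m) + r n \<le> U y" for n
  proof (induction n)
    case 0
    have "a 0 + r 0 = (\<integral>\<^sup>+\<omega>. U y \<partial>M)"
      unfolding a_def r_def
    proof (subst nn_integral_add[symmetric], measurable, intro nn_integral_cong)
      fix \<omega>
      show "(if \<tau> \<omega> = enat 0 then ennreal (\<rho> ^ 0) * U (walk X y 0 \<omega>) else 0) +
          (if enat 0 < \<tau> \<omega> then ennreal (\<rho> ^ 0) * U (walk X y 0 \<omega>) else 0) = U y"
        by (cases "\<tau> \<omega>") (auto simp: walk_def psum_def)
    qed
    then show ?case
      by (simp add: emeasure_space_1)
  next
    case (Suc n)
    have "(\<Sum>m<Suc (Suc n). a m) + r (Suc n) = (\<Sum>m<Suc n. a m) + (a (Suc n) + r (Suc n))"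
      by (simp add: add.assoc)
    also have "\<dots> \<le> (\<Sum>m<Suc n. a m) + r n"
      by (intro add_left_mono r_Suc)
    finally show ?case
      using Suc by (rule order_trans)
  qed
  then have "(\<Sum>m<Suc n. a m) \<le> U y" for n
    by (meson le_iff_add order_trans)
  then have "(\<Sum>m<n. a m) \<le> U y" for n
    by (cases n) auto
  then have "(\<Sum>m. a m) \<le> U y"
    by (intro suminf_le_const) auto
  moreover have "(\<integral>\<^sup>+\<omega>. reward \<rho> g (walk X y) \<tau> \<omega> \<partial>M) \<le> (\<Sum>m. a m)"
  proof -
    have "(\<integral>\<^sup>+\<omega>. reward \<rho> g (walk X y) \<tau> \<omega> \<partial>M) =
        (\<Sum>m. \<integral>\<^sup>+\<omega>. (if \<tau> \<omega> = enat m then ennreal (\<rho> ^ m * g (walk X y m \<omega>)) else 0) \<partial>M)"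
      unfolding reward_eq_suminf by (rule nn_integral_suminf) measurable
    also have "\<dots> \<le> (\<Sum>m. a m)"
      unfolding a_def
      by (intro suminf_le nn_integral_mono) (auto simp: ennreal_mult' rho intro!: mult_left_mono dominates)
    finally show ?thesis .
  qed
  ultimately show ?thesis
    by (rule order_trans[rotated])
qed

section \<open>Optimality of first entrance times\<close>

lemma stop_time_hit:
  assumes markov: "markov_process M A (walk X y)" and [measurable]: "C \<in> sets borel"
  shows "stop_time M A (\<lambda>\<omega>. first_time (\<lambda>n. walk X y n \<omega> \<in> C))"
  unfolding stop_time_def
proof
  fix t
  show "Measurable.pred (case_enat A M t) (\<lambda>\<omega>. first_time (\<lambda>n. walk X y n \<omega> \<in> C) \<le> t)"
  proof (cases t)
    case (enat n)
    have "walk X y m \<in> borel_measurable (A n)" if "m \<le> n" for m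
    proof (rule measurable_from_subalg)
      show "walk X y m \<in> borel_measurable (A m)"
        using markov by (simp add: markov_process_def)
      show "subalgebra (A n) (A m)"
        using markov that filtration.sets_F_mono[of "space M" A m n] filtration.space_F[of "space M" A]
        by (simp add: markov_process_def subalgebra_def)
    qed
    then have walk_in: "Measurable.pred (A n) (\<lambda>\<omega>. walk X y m \<omega> \<in> C)" if "m \<le> n" for m
      using that pred_sets2[OF assms(2)] by blast
    have "Measurable.pred (A n) (\<lambda>\<omega>. m \<le> n \<and> walk X y m \<omega> \<in> C)" for m
      by (cases "m \<le> n") (simp_all add: walk_in)
    then have "Measurable.pred (A n) (\<lambda>\<omega>. \<exists>m. m \<le> n \<and> walk X y m \<omega> \<in> C)"
      by (rule pred_intros_countable)
    then show ?thesis
      by (simp only: enat first_time_le_iff enat.simps)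
  qed simp
qed

lemma phi_eq_ladder_reward:
  assumes [measurable]: "g \<in> borel_measurable borel"
  shows "phi M X \<rho> g y = steps.ladder_reward \<rho> g y"
proof -
  have "phi M X \<rho> g y = (\<integral>\<^sup>+\<omega>. reward \<rho> g (traj y) (next_above 0) (\<lambda>i. X (Suc i) \<omega>) \<partial>M)"
    unfolding phi_def
  proof (intro nn_integral_cong reward_cong)
    fix \<omega>
    show "tau_above X y \<omega> = next_above 0 (\<lambda>i. X (Suc i) \<omega>)"
      unfolding tau_above_def next_above_def walk_eq_traj by (simp add: traj_def)
  qed (simp add: walk_eq_traj)
  also have "\<dots> = steps.ladder_reward \<rho> g y"
    unfolding steps.ladder_reward_def by (rule nn_integral_increments) measurable
  finally show ?thesis .
qed

text \<open>The entrance time of \<open>C\<close> is a stopping time that earns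
  \<open>potential y\<close>, so the value is at least that; conversely the potential is excessive
  and dominates \<open>g\<close>, so no stopping time earns more.\<close>

lemma optimal_hit:
  assumes markov: "\<And>y. markov_process M A (walk X y)"
    and "monotone_stopping step \<rho> g C"
    and fin: "\<And>y. (\<integral>\<^sup>+\<omega>. (SUP n. ennreal (\<rho> ^ n * g (walk X y n \<omega>))) \<partial>M) < \<infinity>"
    and lim: "\<And>y. AE \<omega> in M. (\<lambda>n. \<rho> ^ n * g (walk X y n \<omega>)) \<longlonglongrightarrow> 0"
  shows "optimal_rule M A X \<rho> g (\<lambda>y \<omega>. first_time (\<lambda>n. walk X y n \<omega> \<in> C))"
proof -
  interpret monotone_stopping step \<rho> g C
    by (rule assms(2))
  have lim0: "(\<lambda>N. next_reward N y) \<longlonglongrightarrow> 0" for y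
  proof (rule next_reward_tendsto_0)
    show "(\<integral>\<^sup>+z. (SUP n. ennreal (\<rho> ^ n * g (traj y n z))) \<partial>steps.S) < \<infinity>"
      using fin[of y] unfolding walk_eq_traj
      by (subst (asm) nn_integral_increments[of "\<lambda>z. SUP n. ennreal (\<rho> ^ n * g (traj y n z))"]) auto
    show "AE z in steps.S. (\<lambda>n. \<rho> ^ n * g (traj y n z)) \<longlonglongrightarrow> 0"
      by (rule AE_increments) (use lim[of y] in \<open>auto simp: walk_eq_traj\<close>)
  qed
  have hit_value: "(\<integral>\<^sup>+\<omega>. reward \<rho> g (walk X y) (\<lambda>\<omega>. first_time (\<lambda>n. walk X y n \<omega> \<in> C)) \<omega> \<partial>M) = potential y" for y
  proof -
    have "(\<integral>\<^sup>+\<omega>. reward \<rho> g (walk X y) (\<lambda>\<omega>. first_time (\<lambda>n. walk X y n \<omega> \<in> C)) \<omega> \<partial>M) =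
        (\<integral>\<^sup>+\<omega>. reward \<rho> g (traj y) (hit C y) (\<lambda>i. X (Suc i) \<omega>) \<partial>M)"
      by (intro nn_integral_cong reward_cong) (auto simp: hit_def walk_eq_traj)
    also have "\<dots> = (\<integral>\<^sup>+z. reward \<rho> g (traj y) (hit C y) z \<partial>steps.S)"
      by (rule nn_integral_increments) measurable
    also have "\<dots> = potential y"
      by (rule potential_eq_hit_reward[symmetric]) (rule potential_eq_reward[OF _ lim0])
    finally show ?thesis .
  qed
  have stop: "stop_time M A (\<lambda>\<omega>. first_time (\<lambda>n. walk X y n \<omega> \<in> C))" for y
    by (rule stop_time_hit[OF markov]) simp
  have "value_fun M A X \<rho> g y = potential y" for y
    unfolding value_fun_def
  proof (rule antisym)
    show "(SUP \<tau>\<in>{\<tau>. stop_time M A \<tau>}. \<integral>\<^sup>+\<omega>. reward \<rho> g (walk X y) \<tau> \<omega> \<partial>M) \<le> potential y"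
      using rho g_nonneg
      by (intro SUP_least reward_le_excessive[OF markov])
        (auto intro: potential_excessive reward_le_potential[OF lim0])
    show "potential y \<le> (SUP \<tau>\<in>{\<tau>. stop_time M A \<tau>}. \<integral>\<^sup>+\<omega>. reward \<rho> g (walk X y) \<tau> \<omega> \<partial>M)"
      unfolding hit_value[symmetric] using stop by (intro SUP_upper) simp
  qed
  then show ?thesis
    unfolding optimal_rule_def using stop hit_value by simp
qed

text \<open>The denominator \<open>g z\<close> is a positive constant and factors out of the
  expectation, which leaves \<phi> at \<open>z\<close>.\<close>

lemma ratio_reward_le_1_iff:
  assumes [measurable]: "g \<in> borel_measurable borel" and "0 \<le> \<rho>" and z: "0 < g z" and g: "\<And>y. 0 \<le> g y"
  shows "(\<integral>\<^sup>+\<omega>. reward \<rho> (\<lambda>s. g (z + s) / g z) (psum X) (tau_plus X) \<omega> \<partial>M) \<le> 1 \<longleftrightarrow>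
    phi M X \<rho> g z \<le> ennreal (g z)"
proof -
  have psum: "psum X n \<omega> = traj 0 n (\<lambda>i. X (Suc i) \<omega>)" for n \<omega>
    using walk_eq_traj[of 0 n \<omega>] by (simp add: walk_def)
  have "(\<integral>\<^sup>+\<omega>. reward \<rho> (\<lambda>s. g (z + s) / g z) (psum X) (tau_plus X) \<omega> \<partial>M) =
      (\<integral>\<^sup>+\<omega>. reward \<rho> (\<lambda>s. g (z + s) / g z) (traj 0) (next_above 0) (\<lambda>i. X (Suc i) \<omega>) \<partial>M)"
    by (intro nn_integral_cong reward_cong) (simp_all add: tau_plus_def next_above_def psum)
  also have "\<dots> = (\<integral>\<^sup>+w. reward \<rho> (\<lambda>s. g (z + s) / g z) (traj 0) (next_above 0) w \<partial>steps.S)"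
    by (rule nn_integral_increments) measurable
  also have "\<dots> = (\<integral>\<^sup>+w. ennreal (1 / g z) * reward \<rho> g (traj z) (next_above 0) w \<partial>steps.S)"
    using z g \<open>0 \<le> \<rho>\<close>
    by (intro nn_integral_cong)
      (auto simp: reward_def traj_def ennreal_mult'[symmetric] split: enat.split)
  also have "\<dots> = ennreal (1 / g z) * steps.ladder_reward \<rho> g z"
    unfolding steps.ladder_reward_def by (rule nn_integral_cmult) measurable
  finally have "(\<integral>\<^sup>+\<omega>. reward \<rho> (\<lambda>s. g (z + s) / g z) (psum X) (tau_plus X) \<omega> \<partial>M) \<le> 1 \<longleftrightarrow>
      ennreal (g z) * (ennreal (1 / g z) * steps.ladder_reward \<rho> g z) \<le> ennreal (g z) * 1"
    using z by (subst ennreal_mult_le_mult_iff) auto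
  also have "ennreal (g z) * (ennreal (1 / g z) * steps.ladder_reward \<rho> g z) = phi M X \<rho> g z"
    using z by (simp add: mult.assoc[symmetric] ennreal_mult'[symmetric] phi_eq_ladder_reward)
  finally show ?thesis
    by simp
qed

text \<open>\<open>C\<close> is the open or the closed half-line at \<alpha>; the sign of
  \<open>g - \<phi>\<close> at \<alpha> decides which choice is admissible. For infinite \<alpha>
  the conditions \<open>C_stop\<close> and \<open>C_continue\<close> are void.\<close>

lemma optimal_threshold:
  fixes \<alpha> b :: ereal
  assumes markov: "\<And>y. markov_process M A (walk X y)"
    and rho: "0 < \<rho>" "\<rho> \<le> 1"
    and [measurable]: "g \<in> borel_measurable borel" and g: "\<And>y. 0 \<le> g y"
    and pos_iff: "{y. g y > 0} = {y. ereal y > b}"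
    and alpha: "\<alpha> = alpha_star M X \<rho> g b"
    and mono: "mono_on {y. \<alpha> \<le> ereal y} g"
    and concave: "concave_on {y. \<alpha> < ereal y} (\<lambda>y. ln (g y))"
    and fin: "\<And>y. (\<integral>\<^sup>+\<omega>. (SUP n. ennreal (\<rho> ^ n * g (walk X y n \<omega>))) \<partial>M) < \<infinity>"
    and lim: "\<And>y. AE \<omega> in M. (\<lambda>n. \<rho> ^ n * g (walk X y n \<omega>)) \<longlonglongrightarrow> 0"
    and C: "C \<in> sets borel" "{y. \<alpha> < ereal y} \<subseteq> C" "C \<subseteq> {y. \<alpha> \<le> ereal y}"
    and C_stop: "\<And>a. \<alpha> = ereal a \<Longrightarrow> a \<in> C \<Longrightarrow> phi M X \<rho> g a \<le> ennreal (g a)"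
    and C_continue: "\<And>a. \<alpha> = ereal a \<Longrightarrow> a \<notin> C \<Longrightarrow> ennreal (g a) \<le> phi M X \<rho> g a"
  shows "optimal_rule M A X \<rho> g (\<lambda>y \<omega>. first_time (\<lambda>n. walk X y n \<omega> \<in> C))"
proof (rule optimal_hit[OF markov _ fin lim])
  have alpha_Inf: "\<alpha> = Inf (ereal ` {z. b < ereal z \<and> phi M X \<rho> g z \<le> ennreal (g z)})"
    using alpha by (simp add: alpha_star_def)
  have "b \<le> \<alpha>"
    unfolding alpha_Inf by (rule Inf_greatest) auto
  have pos: "0 < g y" if "\<alpha> < ereal y" for y
    using pos_iff le_less_trans[OF \<open>b \<le> \<alpha>\<close> that] by blast
  have cross: "ennreal (g x) * phi M X \<rho> g y \<le> ennreal (g y) * phi M X \<rho> g x"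
    if "\<alpha> \<le> ereal x" "x \<le> y" for x y
    unfolding phi_eq_ladder_reward[OF assms(4)]
    using log_concave_cross[OF mono concave pos that] rho g
    by (intro steps.ladder_reward_cross) auto
  \<comment> \<open>Above the infimum there is a point \<open>z < y\<close> of the defining set;
    since \<phi> / g decreases, the inequality \<phi> \<le> g passes from \<open>z\<close> to
    \<open>y\<close>.\<close>
  have above: "phi M X \<rho> g y \<le> ennreal (g y)" if y: "\<alpha> < ereal y" for y
  proof -
    obtain z where z: "ereal z < ereal y" "b < ereal z" "phi M X \<rho> g z \<le> ennreal (g z)"
      using y unfolding alpha_Inf Inf_less_iff by auto
    have "\<alpha> \<le> ereal z"
      unfolding alpha_Inf using z by (intro Inf_lower) auto
    have "0 < g z"
      using pos_iff z(2) by blast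
    have "ennreal (g z) * phi M X \<rho> g y \<le> ennreal (g y) * ennreal (g z)"
      using z by (intro order_trans[OF cross[OF \<open>\<alpha> \<le> ereal z\<close>]] mult_left_mono) auto
    then have "ennreal (g z) * phi M X \<rho> g y \<le> ennreal (g z) * ennreal (g y)"
      by (simp add: mult.commute)
    then show ?thesis
      using \<open>0 < g z\<close> by (subst (asm) ennreal_mult_le_mult_iff) auto
  qed
  \<comment> \<open>A point above \<open>b\<close> and below the infimum is not in the defining set,
    which gives g < \<phi>; a point not above \<open>b\<close> has \<open>g y = 0\<close>.\<close>
  have below: "ennreal (g y) \<le> phi M X \<rho> g y" if "ereal y < \<alpha>" for y
  proof (cases "b < ereal y")
    case True
    have "\<alpha> \<le> ereal y" if "phi M X \<rho> g y \<le> ennreal (g y)"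
      unfolding alpha_Inf using True that by (intro Inf_lower) auto
    then have "\<not> phi M X \<rho> g y \<le> ennreal (g y)"
      using that by (meson leD)
    then show ?thesis
      by simp
  next
    case False
    then have "g y = 0"
      using pos_iff g[of y] by (metis (mono_tags, lifting) le_less mem_Collect_eq)
    then show ?thesis
      by simp
  qed
  have stop: "phi M X \<rho> g y \<le> ennreal (g y)" if "y \<in> C" for y
    using above[of y] C_stop[of y] C that by (cases "\<alpha> = ereal y") (auto simp: le_less)
  show "monotone_stopping step \<rho> g C"
  proof
    show "ennreal (g y) \<le> steps.ladder_reward \<rho> g y" if "y \<notin> C" for y
    proof -
      have "ereal y < \<alpha> \<or> \<alpha> = ereal y"
        using C(2) that by (metis (mono_tags, lifting) linorder_less_linear mem_Collect_eq subsetD)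
      then show ?thesis
        unfolding phi_eq_ladder_reward[OF assms(4), symmetric]
        using below[of y] C_continue[of y] that by blast
    qed
    show "steps.ladder_reward \<rho> g y \<le> ennreal (g y)" if "y \<in> C" for y
      using stop[OF that] by (simp add: phi_eq_ladder_reward)
    show "y \<in> C" if "x \<in> C" "x \<le> y" for x y
    proof (cases "x = y")
      case False
      then have "\<alpha> < ereal y"
        using C that by (auto intro: le_less_trans[of \<alpha> "ereal x"])
      then show ?thesis
        using C by auto
    qed (use that in simp)
    show "ennreal (g x) - steps.ladder_reward \<rho> g x \<le> ennreal (g y) - steps.ladder_reward \<rho> g y"
      if "x \<in> C" "x \<le> y" for x y
    proof -
      have x: "\<alpha> \<le> ereal x"
        using C that by auto
      then have "\<alpha> \<le> ereal y"
        using that by (auto intro: order_trans[of \<alpha> "ereal x"])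
      then have "g x \<le> g y"
        using that x by (intro mono_onD[OF mono]) auto
      then show ?thesis
        unfolding phi_eq_ladder_reward[OF assms(4), symmetric]
        using g stop[OF that(1)] cross[OF x that(2)] by (intro ennreal_diff_mono_of_cross) auto
    qed
  qed (use rho g C in auto)
qed

end

section \<open>The formula for the infimum and the two threshold rules\<close>

theorem theorem6p1:
  fixes M :: "'a measure" and A :: "nat \<Rightarrow> 'a measure" and X :: "nat \<Rightarrow> 'a \<Rightarrow> real"
    and \<rho> :: real and g :: "real \<Rightarrow> real" and b \<alpha> :: ereal
  assumes "prob_space M"
    and "iid_increments M X"
    and "measure M {\<omega> \<in> space M. X 1 \<omega> > 0} > 0"
    and "\<And>y. markov_process M A (walk X y)"
    and "0 < \<rho>" and "\<rho> \<le> 1"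
    and "g \<in> borel_measurable borel" and "\<And>y. g y \<ge> 0"
    and "b \<noteq> \<infinity>" and "{y. g y > 0} = {y. ereal y > b}"
    and alpha: "\<alpha> = alpha_star M X \<rho> g b"
  shows
    "\<alpha> = Inf (ereal ` {z. ereal z > b \<and>
           (\<integral>\<^sup>+ \<omega>. reward \<rho> (\<lambda>s. g (z + s) / g z) (psum X) (tau_plus X) \<omega> \<partial>M) \<le> 1})
     \<and>
     (mono_on {y. ereal y \<ge> \<alpha>} g \<and>
      concave_on {y. ereal y > \<alpha>} (\<lambda>y. ln (g y)) \<and>
      (\<forall>y. (\<integral>\<^sup>+ \<omega>. (SUP n. ennreal (\<rho> ^ n * g (walk X y n \<omega>))) \<partial>M) < \<infinity>) \<and>
      (\<forall>y. AE \<omega> in M. (\<lambda>n. \<rho> ^ n * g (walk X y n \<omega>)) \<longlonglongrightarrow> 0)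
      \<longrightarrow>
      ((\<forall>a. \<alpha> = ereal a \<longrightarrow> ennreal (g a) \<ge> phi M X \<rho> g a) \<longrightarrow>
         optimal_rule M A X \<rho> g (\<lambda>y \<omega>. first_time (\<lambda>n. ereal (walk X y n \<omega>) \<ge> \<alpha>)))
      \<and>
      ((\<forall>a. \<alpha> = ereal a \<longrightarrow> ennreal (g a) \<le> phi M X \<rho> g a) \<longrightarrow>
         optimal_rule M A X \<rho> g (\<lambda>y \<omega>. first_time (\<lambda>n. ereal (walk X y n \<omega>) > \<alpha>))))"
proof -
  interpret iid_walk M X
    using assms(1,2) by (intro iid_walk.intro iid_walk_axioms.intro)
  have pos: "0 < g z" if "b < ereal z" for z
    using assms(10) that by blast
  have "\<alpha> = Inf (ereal ` {z. ereal z > b \<and>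
      (\<integral>\<^sup>+ \<omega>. reward \<rho> (\<lambda>s. g (z + s) / g z) (psum X) (tau_plus X) \<omega> \<partial>M) \<le> 1})"
    unfolding alpha alpha_star_def
    using ratio_reward_le_1_iff[OF assms(7), of \<rho>] pos assms(5,8)
    by (intro arg_cong[where f=Inf] image_cong refl Collect_cong conj_cong) auto
  \<comment> \<open>Both rules are first entrance times, differing only in whether the boundary
    point \<alpha> belongs to \<open>C\<close>; each alternative pairs the choice with the sign
    condition it requires.\<close>
  moreover have opt: "optimal_rule M A X \<rho> g (\<lambda>y \<omega>. first_time (\<lambda>n. walk X y n \<omega> \<in> C))"
    if hyps: "mono_on {y. ereal y \<ge> \<alpha>} g"
        "concave_on {y. ereal y > \<alpha>} (\<lambda>y. ln (g y))"
        "\<forall>y. (\<integral>\<^sup>+ \<omega>. (SUP n. ennreal (\<rho> ^ n * g (walk X y n \<omega>))) \<partial>M) < \<infinity>"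
        "\<forall>y. AE \<omega> in M. (\<lambda>n. \<rho> ^ n * g (walk X y n \<omega>)) \<longlonglongrightarrow> 0"
      and C: "C = {y. \<alpha> \<le> ereal y} \<and> (\<forall>a. \<alpha> = ereal a \<longrightarrow> ennreal (g a) \<ge> phi M X \<rho> g a) \<or>
        C = {y. \<alpha> < ereal y} \<and> (\<forall>a. \<alpha> = ereal a \<longrightarrow> ennreal (g a) \<le> phi M X \<rho> g a)"
    for C
  proof (rule optimal_threshold[OF assms(4-8,10) alpha])
    show "C \<in> sets borel"
      using C by auto
  qed (use hyps C in auto)
  ultimately show ?thesis
    using opt[of "{y. \<alpha> \<le> ereal y}"] opt[of "{y. \<alpha> < ereal y}"] by simp
qed

end
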